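(* Let $\lambda,\mu,\nu,\alpha$ be real numbers. Then $H_{\lambda,\mu,\nu}$ is bounded from $L^1_\alpha$ to $L^\infty$ if and only if $$\lambda=\mu+\nu-\alpha\quad\text{and}\quad \mu-\lambda\leq\alpha\leq\mu,$$ or equivalently, if and only if $$\lambda=\mu+\nu-\alpha\quad\text{and}\quad 0\leq\nu\leq\lambda.$$
   Context: Let $p$ be a prime, $\mathbb{Q}_p$ the field of $p$-adic numbers with its norm $|\cdot|_p$ (so $|p|_p=p^{-1}$), $\mathbb{Q}_p^*=\mathbb{Q}_p\setminus\{0\}$, and $dx$ the Haar measure on $\mathbb{Q}_p$ normalized so that $\{x:|x|_p\leq 1\}$ has measure $1$. For $\alpha\in\mathbb{R}$, $L^1_\alpha$ is the space of real-valued measurable functions $f$ on $\mathbb{Q}_p^*$ with $\|f\|_{1,\alpha}=\int_{\mathbb{Q}_p^*}|f(x)||x|_p^\alpha\,dx<\infty$; $L^\infty$ is the space of real-valued measurable functions on $\mathbb{Q}_p^*$ with finite essential supremum norm $\|f\|_\infty$. For real $\lambda,\mu,\nu$ and a real-valued measurable $f$ on $\mathbb{Q}_p^*$, $$H_{\lambda,\mu,\nu}f(y)=\int_{\mathbb{Q}_p^*}\frac{|x|_p^\mu|y|_p^\nu}{[\max\{|x|_p,|y|_p\}]^\lambda}f(x)\,dx,\qquad y\in\mathbb{Q}_p^*.$$ "Bounded from $X$ to $Y$" means that for every $f\in X$ the integral converges absolutely for almost every $y$ and there is a constant $C$ with $\|H_{\lambda,\mu,\nu}f\|_Y\leq C\|f\|_X$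 for all $f\in X$. *)

theory Defs
  imports "HOL-Probability.Probability" "HOL-Algebra.QuotRing"
    "HOL-Computational_Algebra.Primes"
begin

section \<open>The field of p-adic numbers as the completion of the rationals\<close>

definition rat_padic_norm :: "nat \<Rightarrow> rat \<Rightarrow> real" where
  "rat_padic_norm p q = (if q = 0 then 0 else
     (case quotient_of q of (a, b) \<Rightarrow>
        real p powi (int (multiplicity (int p) b) - int (multiplicity (int p) a))))"

definition padic_cauchy :: "nat \<Rightarrow> (nat \<Rightarrow> rat) \<Rightarrow> bool" where
  "padic_cauchy p s \<longleftrightarrow>
     (\<forall>e>0. \<exists>N. \<forall>m\<ge>N. \<forall>n\<ge>N. rat_padic_norm p (s m - s n) < e)"

definition padic_cauchy_ring :: "nat \<Rightarrow> (nat \<Rightarrow> rat) ring" where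
  "padic_cauchy_ring p =
     \<lparr>carrier = {s. padic_cauchy p s}, mult = (\<lambda>s t n. s n * t n), one = (\<lambda>n. 1),
      zero = (\<lambda>n. 0), add = (\<lambda>s t n. s n + t n)\<rparr>"

definition padic_null :: "nat \<Rightarrow> (nat \<Rightarrow> rat) set" where
  "padic_null p = {s. (\<lambda>n. rat_padic_norm p (s n)) \<longlonglongrightarrow> 0}"

definition Qp :: "nat \<Rightarrow> (nat \<Rightarrow> rat) set ring" where
  "Qp p = padic_cauchy_ring p Quot padic_null p"

definition padic_norm :: "nat \<Rightarrow> (nat \<Rightarrow> rat) set \<Rightarrow> real" where
  "padic_norm p x = (THE r. \<exists>s\<in>x. (\<lambda>n. rat_padic_norm p (s n)) \<longlonglongrightarrow> r)"

lemma rat_padic_norm_0 [simp]: "rat_padic_norm p 0 = 0"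
  by (simp add: rat_padic_norm_def)

context
  fixes p :: nat
  assumes p: "prime p"
begin

lemma rat_padic_norm_frac:
  assumes "a \<noteq> 0" "b \<noteq> 0"
  shows "rat_padic_norm p (of_int a / of_int b) =
    real p powi (int (multiplicity (int p) b) - int (multiplicity (int p) a))"
proof -
  let ?q = "of_int a / of_int b :: rat"
  obtain c d where cd: "quotient_of ?q = (c, d)" by force
  have d: "d > 0" using quotient_of_denom_pos[OF cd] .
  have q: "?q = of_int c / of_int d" using quotient_of_div[OF cd] .
  have c: "c \<noteq> 0" using q assms d by auto
  have "of_int a * of_int d = (of_int c * of_int b :: rat)"
    using q assms d by (simp add: field_simps)
  hence "a * d = c * b" by (metis of_int_eq_iff of_int_mult)
  hence "multiplicity (int p) (a * d) = multiplicity (int p) (c * b)" by simp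
  hence "multiplicity (int p) a + multiplicity (int p) d
      = multiplicity (int p) c + multiplicity (int p) b"
    using assms c d p by (simp add: prime_elem_multiplicity_mult_distrib)
  hence e: "int (multiplicity (int p) d) - int (multiplicity (int p) c) =
     int (multiplicity (int p) b) - int (multiplicity (int p) a)" by linarith
  have "?q \<noteq> 0" using assms by simp
  thus ?thesis using cd e by (simp add: rat_padic_norm_def)
qed

lemma rat_padic_norm_nonneg [simp]: "rat_padic_norm p q \<ge> 0"
  by (auto simp: rat_padic_norm_def split: prod.split)

lemma rat_padic_norm_eq_0_iff [simp]: "rat_padic_norm p q = 0 \<longleftrightarrow> q = 0"
  using p by (auto simp: rat_padic_norm_def prime_gt_0_nat split: prod.split)

lemma rat_as_frac:
  obtains a b :: int where "b > 0" "q = (of_int a / of_int b :: rat)"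
  by (metis quotient_of_denom_pos quotient_of_div surj_pair)

lemma rat_padic_norm_mult: "rat_padic_norm p (q * r) = rat_padic_norm p q * rat_padic_norm p r"
proof (cases "q = 0 \<or> r = 0")
  case False
  obtain a b where q: "b > 0" "q = (of_int a / of_int b :: rat)" by (rule rat_as_frac)
  obtain c d where r: "d > 0" "r = (of_int c / of_int d :: rat)" by (rule rat_as_frac)
  have nz: "a \<noteq> 0" "c \<noteq> 0" "b \<noteq> 0" "d \<noteq> 0" using False q r by auto
  have "q * r = of_int (a * c) / of_int (b * d)" using q r by simp
  hence "rat_padic_norm p (q * r) = real p powi (int (multiplicity (int p) (b*d)) - int (multiplicity (int p) (a*c)))"
    using rat_padic_norm_frac[of "a*c" "b*d"] nz by simp
  also have "\<dots> = real p powi ((int (multiplicity (int p) b) - int (multiplicity (int p) a))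
       + (int (multiplicity (int p) d) - int (multiplicity (int p) c)))"
    using nz p by (simp add: prime_elem_multiplicity_mult_distrib algebra_simps)
  also have "\<dots> = rat_padic_norm p q * rat_padic_norm p r"
    using nz q r p by (simp add: rat_padic_norm_frac power_int_add prime_gt_0_nat)
  finally show ?thesis .
qed auto

lemma rat_padic_norm_1 [simp]: "rat_padic_norm p 1 = 1"
  using rat_padic_norm_frac[of 1 1] by simp

lemma rat_padic_norm_minus [simp]: "rat_padic_norm p (- q) = rat_padic_norm p q"
proof -
  have "rat_padic_norm p (-1) = 1"
    using rat_padic_norm_frac[of "-1" 1] by (simp add: multiplicity_unit_right)
  thus ?thesis using rat_padic_norm_mult[of "-1" q] by simp
qed

lemma rat_padic_norm_of_int_le:
  "rat_padic_norm p (of_int a) \<le> real p powi (- int k) \<longleftrightarrow> int p ^ k dvd a"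
proof (cases "a = 0")
  case False
  have p1: "real p > 1" using p prime_gt_1_nat by auto
  have "rat_padic_norm p (of_int a) = real p powi (- int (multiplicity (int p) a))"
    using rat_padic_norm_frac[OF False, of 1] by simp
  also have "\<dots> \<le> real p powi (- int k) \<longleftrightarrow> k \<le> multiplicity (int p) a"
    using p1 power_int_strict_increasing[of "- int k" "- int (multiplicity (int p) a)" "real p"]
      power_int_increasing[of "- int (multiplicity (int p) a)" "- int k" "real p"]
    by (cases "k \<le> multiplicity (int p) a") auto
  also have "\<dots> \<longleftrightarrow> int p ^ k dvd a"
    using False p by (intro power_dvd_iff_le_multiplicity[symmetric]) (auto simp: prime_gt_1_nat)
  finally show ?thesis .
qed (simp)

lemma rat_padic_norm_of_int_le_1: "rat_padic_norm p (of_int a) \<le> 1"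
  using rat_padic_norm_of_int_le[of a 0] by simp

lemma rat_padic_norm_p: "rat_padic_norm p (of_nat p) = 1 / real p"
  using rat_padic_norm_frac[of "int p" 1] p by (simp add: prime_gt_0_nat power_int_minus field_simps)

lemma rat_padic_norm_p_power: "rat_padic_norm p (of_nat p ^ n) = 1 / real p ^ n"
  by (induction n) (auto simp: rat_padic_norm_mult rat_padic_norm_p)

lemma rat_padic_norm_add: "rat_padic_norm p (q + r) \<le> max (rat_padic_norm p q) (rat_padic_norm p r)"
proof -
  obtain a b where q: "b > 0" "q = (of_int a / of_int b :: rat)" by (rule rat_as_frac)
  obtain c d where r: "d > 0" "r = (of_int c / of_int d :: rat)" by (rule rat_as_frac)
  define z where "z = (of_int (b * d) :: rat)"
  have z: "z \<noteq> 0" using q r by (simp add: z_def)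
  have int: "rat_padic_norm p (of_int x + of_int y) \<le> max (rat_padic_norm p (of_int x)) (rat_padic_norm p (of_int y))"
    for x y :: int
  proof (cases "x = 0 \<or> y = 0")
    case False
    define k where "k = min (multiplicity (int p) x) (multiplicity (int p) y)"
    have "int p ^ k dvd x" "int p ^ k dvd y" by (auto simp: k_def multiplicity_dvd')
    hence "int p ^ k dvd x + y" by simp
    hence "rat_padic_norm p (of_int (x + y)) \<le> real p powi (- int k)"
      using rat_padic_norm_of_int_le by blast
    also have "\<dots> \<le> max (rat_padic_norm p (of_int x)) (rat_padic_norm p (of_int y))"
      using False rat_padic_norm_frac[of x 1] rat_padic_norm_frac[of y 1]
      by (auto simp: k_def min_def)
    finally show ?thesis by simp
  qed auto
  have e: "q * z = of_int (a * d)" "r * z = of_int (c * b)" using q r by (auto simp: z_def)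
  have "rat_padic_norm p (q + r) * rat_padic_norm p z = rat_padic_norm p (of_int (a*d) + of_int (c*b))"
    by (simp add: rat_padic_norm_mult[symmetric] distrib_right e)
  also have "\<dots> \<le> max (rat_padic_norm p (q * z)) (rat_padic_norm p (r * z))"
    unfolding e by (rule int)
  also have "\<dots> = max (rat_padic_norm p q) (rat_padic_norm p r) * rat_padic_norm p z"
    by (simp add: rat_padic_norm_mult max_mult_distrib_right)
  finally show ?thesis using z
    by (metis mult_le_cancel_right_pos rat_padic_norm_eq_0_iff rat_padic_norm_nonneg less_eq_real_def)
qed

lemma rat_padic_norm_diff: "rat_padic_norm p (q - r) \<le> max (rat_padic_norm p q) (rat_padic_norm p r)"
  using rat_padic_norm_add[of q "-r"] by simp

lemma rat_padic_norm_commute: "rat_padic_norm p (q - r) = rat_padic_norm p (r - q)"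
  using rat_padic_norm_minus[of "q - r"] by simp

lemma rat_padic_norm_triangle: "rat_padic_norm p (q + r) \<le> rat_padic_norm p q + rat_padic_norm p r"
  using rat_padic_norm_add[of q r] rat_padic_norm_nonneg[of q] rat_padic_norm_nonneg[of r] by linarith

lemma rat_padic_norm_abs_diff: "\<bar>rat_padic_norm p q - rat_padic_norm p r\<bar> \<le> rat_padic_norm p (q - r)"
  using rat_padic_norm_triangle[of "q - r" r] rat_padic_norm_triangle[of "r - q" q]
    rat_padic_norm_commute[of q r] by simp

lemma padic_cauchy_convergent:
  assumes "padic_cauchy p s"
  shows "convergent (\<lambda>n. rat_padic_norm p (s n))"
proof -
  have "Cauchy (\<lambda>n. rat_padic_norm p (s n))"
  proof (rule CauchyI)
    fix e :: real assume "0 < e"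
    then obtain N where N: "\<forall>m\<ge>N. \<forall>n\<ge>N. rat_padic_norm p (s m - s n) < e"
      using assms by (auto simp: padic_cauchy_def)
    show "\<exists>M. \<forall>m\<ge>M. \<forall>n\<ge>M. norm (rat_padic_norm p (s m) - rat_padic_norm p (s n)) < e"
      using N by (intro exI[of _ N]) (auto intro: le_less_trans[OF rat_padic_norm_abs_diff])
  qed
  thus ?thesis by (simp add: Cauchy_convergent_iff)
qed

lemma padic_cauchy_bounded:
  assumes "padic_cauchy p s"
  obtains B where "B > 0" "\<And>n. rat_padic_norm p (s n) \<le> B"
proof -
  have "Bseq (\<lambda>n. rat_padic_norm p (s n))"
    using padic_cauchy_convergent[OF assms] convergent_imp_Bseq by blast
  thus ?thesis using that by (auto simp: Bseq_def)
qed

lemma padic_cauchy_add: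
  assumes "padic_cauchy p s" "padic_cauchy p t"
  shows "padic_cauchy p (\<lambda>n. s n + t n)"
  unfolding padic_cauchy_def
proof (intro allI impI)
  fix e :: real assume "e > 0"
  then obtain N M where N: "\<forall>m\<ge>N. \<forall>n\<ge>N. rat_padic_norm p (s m - s n) < e"
    and M: "\<forall>m\<ge>M. \<forall>n\<ge>M. rat_padic_norm p (t m - t n) < e"
    using assms unfolding padic_cauchy_def by meson
  have "rat_padic_norm p (s m + t m - (s n + t n)) < e" if "m \<ge> max M N" "n \<ge> max M N" for m n
  proof -
    have "rat_padic_norm p ((s m - s n) + (t m - t n)) < e"
    proof -
      have "rat_padic_norm p (s m - s n) < e" "rat_padic_norm p (t m - t n) < e" using N M that by auto
      thus ?thesis using rat_padic_norm_add[of "s m - s n" "t m - t n"] by linarith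
    qed
    thus ?thesis by (simp add: algebra_simps)
  qed
  thus "\<exists>N. \<forall>m\<ge>N. \<forall>n\<ge>N. rat_padic_norm p (s m + t m - (s n + t n)) < e" by blast
qed

lemma padic_cauchy_minus: "padic_cauchy p s \<Longrightarrow> padic_cauchy p (\<lambda>n. - s n)"
proof -
  have "rat_padic_norm p (- s m - - s n) = rat_padic_norm p (s m - s n)" for m n
    using rat_padic_norm_minus[of "s m - s n"] by (simp only: minus_diff_minus)
  thus "padic_cauchy p s \<Longrightarrow> padic_cauchy p (\<lambda>n. - s n)" unfolding padic_cauchy_def by presburger
qed

lemma padic_cauchy_const [simp]: "padic_cauchy p (\<lambda>n. c)"
  by (auto simp: padic_cauchy_def)

lemma padic_cauchy_mult:
  assumes "padic_cauchy p s" "padic_cauchy p t"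
  shows "padic_cauchy p (\<lambda>n. s n * t n)"
  unfolding padic_cauchy_def
proof (intro allI impI)
  fix e :: real assume e: "e > 0"
  obtain B where B: "B > 0" "\<And>n. rat_padic_norm p (s n) \<le> B" using padic_cauchy_bounded[OF assms(1)] by blast
  obtain C where C: "C > 0" "\<And>n. rat_padic_norm p (t n) \<le> C" using padic_cauchy_bounded[OF assms(2)] by blast
  have "e / C > 0" "e / B > 0" using e B C by auto
  then obtain N M where N: "\<forall>m\<ge>N. \<forall>n\<ge>N. rat_padic_norm p (s m - s n) < e / C"
    and M: "\<forall>m\<ge>M. \<forall>n\<ge>M. rat_padic_norm p (t m - t n) < e / B"
    using assms unfolding padic_cauchy_def by meson
  have "rat_padic_norm p (s m * t m - s n * t n) < e" if "m \<ge> max M N" "n \<ge> max M N" for m n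
  proof -
    have "s m * t m - s n * t n = (s m - s n) * t m + s n * (t m - t n)" by (simp add: algebra_simps)
    moreover have "rat_padic_norm p ((s m - s n) * t m) < e"
    proof -
      have "rat_padic_norm p (s m - s n) * rat_padic_norm p (t m) \<le> rat_padic_norm p (s m - s n) * C"
        using C by (intro mult_left_mono) auto
      also have "\<dots> < e" using N that C by (simp add: pos_less_divide_eq)
      finally show ?thesis by (simp add: rat_padic_norm_mult)
    qed
    moreover have "rat_padic_norm p (s n * (t m - t n)) < e"
    proof -
      have "rat_padic_norm p (s n) * rat_padic_norm p (t m - t n) \<le> B * rat_padic_norm p (t m - t n)"
        using B by (intro mult_right_mono) auto
      also have "\<dots> < e" using M that B by (simp add: pos_less_divide_eq mult.commute)
      finally show ?thesis by (simp add: rat_padic_norm_mult)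
    qed
    ultimately show ?thesis
      using rat_padic_norm_add[of "(s m - s n) * t m" "s n * (t m - t n)"] by simp
  qed
  thus "\<exists>N. \<forall>m\<ge>N. \<forall>n\<ge>N. rat_padic_norm p (s m * t m - s n * t n) < e" by blast
qed

lemma padic_null_cauchy:
  assumes "s \<in> padic_null p"
  shows "padic_cauchy p s"
  unfolding padic_cauchy_def
proof (intro allI impI)
  fix e :: real assume e: "e > 0"
  then obtain N where N: "\<forall>n\<ge>N. rat_padic_norm p (s n) < e"
    using assms by (auto simp: padic_null_def LIMSEQ_iff)
  thus "\<exists>N. \<forall>m\<ge>N. \<forall>n\<ge>N. rat_padic_norm p (s m - s n) < e"
    by (intro exI[of _ N]) (auto intro: le_less_trans[OF rat_padic_norm_diff])
qed

lemma padic_null_add: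
  assumes "s \<in> padic_null p" "t \<in> padic_null p"
  shows "(\<lambda>n. s n + t n) \<in> padic_null p"
proof -
  have "(\<lambda>n. rat_padic_norm p (s n) + rat_padic_norm p (t n)) \<longlonglongrightarrow> 0"
    using assms tendsto_add[of _ "0::real" _ _ "0::real"] by (auto simp: padic_null_def)
  hence "(\<lambda>n. rat_padic_norm p (s n + t n)) \<longlonglongrightarrow> 0"
    by (rule Lim_null_comparison[rotated]) (simp add: rat_padic_norm_triangle)
  thus ?thesis by (simp add: padic_null_def)
qed

lemma padic_null_minus: "s \<in> padic_null p \<Longrightarrow> (\<lambda>n. - s n) \<in> padic_null p"
  by (simp add: padic_null_def)

lemma padic_null_mult:
  assumes "s \<in> padic_null p" "padic_cauchy p t"
  shows "(\<lambda>n. s n * t n) \<in> padic_null p"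
proof -
  obtain L where "(\<lambda>n. rat_padic_norm p (t n)) \<longlonglongrightarrow> L"
    using padic_cauchy_convergent[OF assms(2)] by (auto simp: convergent_def)
  hence "(\<lambda>n. rat_padic_norm p (s n) * rat_padic_norm p (t n)) \<longlonglongrightarrow> 0 * L"
    using assms by (intro tendsto_mult) (auto simp: padic_null_def)
  thus ?thesis by (simp add: padic_null_def rat_padic_norm_mult)
qed

lemma padic_cauchy_ring_cring: "cring (padic_cauchy_ring p)"
proof (rule cringI)
  show "abelian_group (padic_cauchy_ring p)"
  proof (rule abelian_groupI)
    fix x assume "x \<in> carrier (padic_cauchy_ring p)"
    thus "\<exists>y\<in>carrier (padic_cauchy_ring p). y \<oplus>\<^bsub>padic_cauchy_ring p\<^esub> x = \<zero>\<^bsub>padic_cauchy_ring p\<^esub>"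
      by (intro bexI[of _ "\<lambda>n. - x n"]) (auto simp: padic_cauchy_ring_def padic_cauchy_minus)
  qed (auto simp: padic_cauchy_ring_def padic_cauchy_add algebra_simps)
  show "comm_monoid (padic_cauchy_ring p)"
    by (rule comm_monoidI) (auto simp: padic_cauchy_ring_def padic_cauchy_mult algebra_simps)
qed (auto simp: padic_cauchy_ring_def algebra_simps)

lemma padic_null_ideal: "ideal (padic_null p) (padic_cauchy_ring p)"
proof (rule idealI)
  interpret R: cring "padic_cauchy_ring p" by (rule padic_cauchy_ring_cring)
  show "ring (padic_cauchy_ring p)" by (rule R.ring_axioms)
  show "subgroup (padic_null p) (add_monoid (padic_cauchy_ring p))"
  proof (rule group.subgroupI)
    show "Group.group (add_monoid (padic_cauchy_ring p))" by (rule R.a_group)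
    show "padic_null p \<noteq> {}" by (auto simp: padic_null_def intro!: exI[of _ "\<lambda>_. 0"])
  next
    fix a assume a: "a \<in> padic_null p"
    hence ac: "a \<in> carrier (padic_cauchy_ring p)" by (simp add: padic_cauchy_ring_def padic_null_cauchy)
    have "\<ominus>\<^bsub>padic_cauchy_ring p\<^esub> a = (\<lambda>n. - a n)"
      by (rule R.minus_equality) (use ac in \<open>auto simp: padic_cauchy_ring_def padic_cauchy_minus\<close>)
    thus "inv\<^bsub>add_monoid (padic_cauchy_ring p)\<^esub> a \<in> padic_null p"
      using a by (simp add: a_inv_def padic_null_minus)
  qed (auto simp: padic_cauchy_ring_def padic_null_add padic_null_cauchy)
next
  fix a x assume a: "a \<in> padic_null p" and x: "x \<in> carrier (padic_cauchy_ring p)"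
  hence *: "(\<lambda>n. a n * x n) \<in> padic_null p" by (simp add: padic_cauchy_ring_def padic_null_mult)
  show "a \<otimes>\<^bsub>padic_cauchy_ring p\<^esub> x \<in> padic_null p"
    using * by (simp add: padic_cauchy_ring_def)
  have "(\<lambda>n. x n * a n) = (\<lambda>n. a n * x n)" by (simp add: mult.commute)
  thus "x \<otimes>\<^bsub>padic_cauchy_ring p\<^esub> a \<in> padic_null p"
    using * by (simp add: padic_cauchy_ring_def)
qed

end

definition padic_class :: "nat \<Rightarrow> (nat \<Rightarrow> rat) \<Rightarrow> (nat \<Rightarrow> rat) set" where
  "padic_class p s = padic_null p +>\<^bsub>padic_cauchy_ring p\<^esub> s"

context
  fixes p :: nat
  assumes p: "prime p"
begin

interpretation R: cring "padic_cauchy_ring p" by (rule padic_cauchy_ring_cring[OF p])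
interpretation I: ideal "padic_null p" "padic_cauchy_ring p" by (rule padic_null_ideal[OF p])

lemma padic_class_altdef: "padic_class p s = {t. (\<lambda>n. t n - s n) \<in> padic_null p}"
proof (intro equalityI subsetI)
  fix t assume "t \<in> {t. (\<lambda>n. t n - s n) \<in> padic_null p}"
  thus "t \<in> padic_class p s"
    by (auto simp: padic_class_def a_r_coset_def' padic_cauchy_ring_def intro!: bexI[of _ "\<lambda>n. t n - s n"])
qed (auto simp: padic_class_def a_r_coset_def' padic_cauchy_ring_def)

lemma carrier_Qp: "carrier (Qp p) = padic_class p ` {s. padic_cauchy p s}"
proof -
  have "carrier (Qp p) = (\<Union>s\<in>carrier (padic_cauchy_ring p). {padic_class p s})"
    unfolding Qp_def FactRing_simps padic_class_def by simp
  also have "carrier (padic_cauchy_ring p) = {s. padic_cauchy p s}"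
    by (simp add: padic_cauchy_ring_def)
  finally show ?thesis by auto
qed

lemma padic_class_in_carrier [simp]: "padic_cauchy p s \<Longrightarrow> padic_class p s \<in> carrier (Qp p)"
  by (simp add: carrier_Qp)

lemma padic_class_self: "s \<in> padic_class p s"
  by (simp add: padic_class_altdef padic_null_def)

lemma padic_class_eq_iff: "padic_class p s = padic_class p t \<longleftrightarrow> (\<lambda>n. s n - t n) \<in> padic_null p"
proof
  assume "padic_class p s = padic_class p t"
  thus "(\<lambda>n. s n - t n) \<in> padic_null p" using padic_class_self[of s] by (simp add: padic_class_altdef)
next
  assume *: "(\<lambda>n. s n - t n) \<in> padic_null p"
  show "padic_class p s = padic_class p t"
  proof (intro equalityI subsetI)
    fix u assume "u \<in> padic_class p s"
    hence "(\<lambda>n. u n - s n) \<in> padic_null p" by (simp add: padic_class_altdef)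
    from padic_null_add[OF p this *] show "u \<in> padic_class p t" by (simp add: padic_class_altdef)
  next
    fix u assume "u \<in> padic_class p t"
    hence "(\<lambda>n. u n - t n) \<in> padic_null p" by (simp add: padic_class_altdef)
    from padic_null_add[OF p this padic_null_minus[OF p *]] show "u \<in> padic_class p s" by (simp add: padic_class_altdef)
  qed
qed

lemma Qp_cring: "cring (Qp p)"
  unfolding Qp_def by (rule I.quotient_is_cring[OF R.is_cring])

lemma Qp_class_add:
  assumes "padic_cauchy p s" "padic_cauchy p t"
  shows "padic_class p s \<oplus>\<^bsub>Qp p\<^esub> padic_class p t = padic_class p (\<lambda>n. s n + t n)"
  using I.a_rcos_sum[of s t] assms
  by (simp add: Qp_def FactRing_def padic_class_def padic_cauchy_ring_def)

lemma Qp_class_mult: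
  assumes "padic_cauchy p s" "padic_cauchy p t"
  shows "padic_class p s \<otimes>\<^bsub>Qp p\<^esub> padic_class p t = padic_class p (\<lambda>n. s n * t n)"
  using I.rcoset_mult_add[of s t] assms
  by (simp add: Qp_def FactRing_def padic_class_def padic_cauchy_ring_def)

lemma Qp_zero: "\<zero>\<^bsub>Qp p\<^esub> = padic_class p (\<lambda>n. 0)"
  by (auto simp: Qp_def FactRing_def padic_class_altdef)

lemma Qp_one: "\<one>\<^bsub>Qp p\<^esub> = padic_class p (\<lambda>n. 1)"
  by (simp add: Qp_def FactRing_def padic_class_def padic_cauchy_ring_def)

lemma Qp_class_diff:
  assumes "padic_cauchy p s" "padic_cauchy p t"
  shows "padic_class p s \<ominus>\<^bsub>Qp p\<^esub> padic_class p t = padic_class p (\<lambda>n. s n - t n)"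
proof -
  interpret Q: cring "Qp p" by (rule Qp_cring)
  have "\<ominus>\<^bsub>Qp p\<^esub> padic_class p t = padic_class p (\<lambda>n. - t n)"
    by (rule Q.minus_equality)
      (use assms in \<open>auto simp: Qp_class_add padic_cauchy_minus[OF p] Qp_zero\<close>)
  thus ?thesis using assms
    by (simp add: a_minus_def Qp_class_add padic_cauchy_minus[OF p])
qed

lemma padic_cauchy_diff:
  "padic_cauchy p s \<Longrightarrow> padic_cauchy p t \<Longrightarrow> padic_cauchy p (\<lambda>n. s n - t n)"
  using padic_cauchy_add[OF p _ padic_cauchy_minus[OF p], of s t] by simp

lemma padic_norm_eqI:
  assumes "(\<lambda>n. rat_padic_norm p (s n)) \<longlonglongrightarrow> r"
  shows "padic_norm p (padic_class p s) = r"
  unfolding padic_norm_def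
proof (rule the_equality)
  show "\<exists>t\<in>padic_class p s. (\<lambda>n. rat_padic_norm p (t n)) \<longlonglongrightarrow> r"
    using assms padic_class_self by blast
next
  fix r' assume "\<exists>t\<in>padic_class p s. (\<lambda>n. rat_padic_norm p (t n)) \<longlonglongrightarrow> r'"
  then obtain t where t: "t \<in> padic_class p s" "(\<lambda>n. rat_padic_norm p (t n)) \<longlonglongrightarrow> r'" by blast
  have "(\<lambda>n. rat_padic_norm p (t n - s n)) \<longlonglongrightarrow> 0"
    using t by (simp add: padic_class_altdef padic_null_def)
  hence "(\<lambda>n. rat_padic_norm p (t n) - rat_padic_norm p (s n)) \<longlonglongrightarrow> 0"
    by (rule Lim_null_comparison[rotated]) (simp add: rat_padic_norm_abs_diff[OF p])
  moreover have "(\<lambda>n. rat_padic_norm p (t n) - rat_padic_norm p (s n)) \<longlonglongrightarrow> r' - r"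
    using t assms by (intro tendsto_diff)
  ultimately show "r' = r" using LIMSEQ_unique by fastforce
qed

lemma padic_norm_class:
  assumes "padic_cauchy p s"
  shows "(\<lambda>n. rat_padic_norm p (s n)) \<longlonglongrightarrow> padic_norm p (padic_class p s)"
  using padic_cauchy_convergent[OF p assms] padic_norm_eqI by (metis convergent_def)

lemma padic_norm_const: "padic_norm p (padic_class p (\<lambda>n. q)) = rat_padic_norm p q"
  by (rule padic_norm_eqI) simp

lemma Qp_cases:
  assumes "x \<in> carrier (Qp p)"
  obtains s where "padic_cauchy p s" "x = padic_class p s"
  using assms by (auto simp: carrier_Qp)

lemma padic_norm_nonneg: "x \<in> carrier (Qp p) \<Longrightarrow> padic_norm p x \<ge> 0"
  by (elim Qp_cases) (metis LIMSEQ_le_const p padic_norm_class rat_padic_norm_nonneg)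

lemma padic_norm_eq_0_iff:
  assumes "x \<in> carrier (Qp p)"
  shows "padic_norm p x = 0 \<longleftrightarrow> x = \<zero>\<^bsub>Qp p\<^esub>"
proof -
  obtain s where s: "padic_cauchy p s" "x = padic_class p s" using assms by (rule Qp_cases)
  show ?thesis
    using padic_norm_class[OF s(1)] padic_norm_eqI[of s 0]
    by (auto simp: s Qp_zero padic_class_eq_iff padic_null_def)
qed

lemma padic_norm_mult:
  assumes "x \<in> carrier (Qp p)" "y \<in> carrier (Qp p)"
  shows "padic_norm p (x \<otimes>\<^bsub>Qp p\<^esub> y) = padic_norm p x * padic_norm p y"
proof -
  obtain s where s: "padic_cauchy p s" "x = padic_class p s" using assms(1) by (rule Qp_cases)
  obtain t where t: "padic_cauchy p t" "y = padic_class p t" using assms(2) by (rule Qp_cases)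
  have "(\<lambda>n. rat_padic_norm p (s n * t n)) \<longlonglongrightarrow> padic_norm p x * padic_norm p y"
    using tendsto_mult[OF padic_norm_class[OF s(1)] padic_norm_class[OF t(1)]]
    by (simp add: rat_padic_norm_mult[OF p] s t)
  thus ?thesis using s t by (simp add: Qp_class_mult padic_norm_eqI)
qed

lemma padic_norm_add:
  assumes "x \<in> carrier (Qp p)" "y \<in> carrier (Qp p)"
  shows "padic_norm p (x \<oplus>\<^bsub>Qp p\<^esub> y) \<le> max (padic_norm p x) (padic_norm p y)"
proof -
  obtain s where s: "padic_cauchy p s" "x = padic_class p s" using assms(1) by (rule Qp_cases)
  obtain t where t: "padic_cauchy p t" "y = padic_class p t" using assms(2) by (rule Qp_cases)
  have M: "(\<lambda>n. max (rat_padic_norm p (s n)) (rat_padic_norm p (t n))) \<longlonglongrightarrow> max (padic_norm p x) (padic_norm p y)"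
    using tendsto_max[OF padic_norm_class[OF s(1)] padic_norm_class[OF t(1)]] by (simp add: s t)
  have A: "(\<lambda>n. rat_padic_norm p (s n + t n)) \<longlonglongrightarrow> padic_norm p (x \<oplus>\<^bsub>Qp p\<^esub> y)"
    using padic_norm_class[OF padic_cauchy_add[OF p s(1) t(1)]] s t by (simp add: Qp_class_add)
  show ?thesis by (rule LIMSEQ_le[OF A M]) (simp add: rat_padic_norm_add[OF p])
qed

lemma Qp_diff_closed: "x \<in> carrier (Qp p) \<Longrightarrow> y \<in> carrier (Qp p) \<Longrightarrow> x \<ominus>\<^bsub>Qp p\<^esub> y \<in> carrier (Qp p)"
  by (rule ring.ring_simprules(4)[OF cring.axioms(1)[OF Qp_cring]])

lemma padic_norm_diff_commute:
  assumes "x \<in> carrier (Qp p)" "y \<in> carrier (Qp p)"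
  shows "padic_norm p (x \<ominus>\<^bsub>Qp p\<^esub> y) = padic_norm p (y \<ominus>\<^bsub>Qp p\<^esub> x)"
proof -
  obtain s where s: "padic_cauchy p s" "x = padic_class p s" using assms(1) by (rule Qp_cases)
  obtain t where t: "padic_cauchy p t" "y = padic_class p t" using assms(2) by (rule Qp_cases)
  have "(\<lambda>n. rat_padic_norm p (t n - s n)) \<longlonglongrightarrow> padic_norm p (padic_class p (\<lambda>n. s n - t n))"
    using padic_norm_class[OF padic_cauchy_diff[OF s(1) t(1)]]
    by (subst rat_padic_norm_commute[OF p])
  from padic_norm_eqI[OF this] show ?thesis using s t by (simp add: Qp_class_diff)
qed

lemma padic_norm_diff_trans:
  assumes "x \<in> carrier (Qp p)" "y \<in> carrier (Qp p)" "z \<in> carrier (Qp p)"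
  shows "padic_norm p (x \<ominus>\<^bsub>Qp p\<^esub> z) \<le>
    max (padic_norm p (x \<ominus>\<^bsub>Qp p\<^esub> y)) (padic_norm p (y \<ominus>\<^bsub>Qp p\<^esub> z))"
proof -
  interpret Q: cring "Qp p" by (rule Qp_cring)
  have "x \<ominus>\<^bsub>Qp p\<^esub> z = (x \<ominus>\<^bsub>Qp p\<^esub> y) \<oplus>\<^bsub>Qp p\<^esub> (y \<ominus>\<^bsub>Qp p\<^esub> z)"
    using assms by algebra
  thus ?thesis using assms by (simp add: padic_norm_add)
qed

lemma padic_rat_dense:
  assumes "x \<in> carrier (Qp p)" "e > 0"
  obtains q where "padic_norm p (x \<ominus>\<^bsub>Qp p\<^esub> padic_class p (\<lambda>n. q)) \<le> e"
proof -
  obtain s where s: "padic_cauchy p s" "x = padic_class p s" using assms(1) by (rule Qp_cases)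
  obtain N where N: "\<forall>m\<ge>N. \<forall>n\<ge>N. rat_padic_norm p (s m - s n) < e"
    using s(1) assms(2) unfolding padic_cauchy_def by meson
  have "(\<lambda>n. rat_padic_norm p (s n - s N)) \<longlonglongrightarrow> padic_norm p (x \<ominus>\<^bsub>Qp p\<^esub> padic_class p (\<lambda>n. s N))"
    using padic_norm_class[OF padic_cauchy_diff[OF s(1) padic_cauchy_const[OF p]]] s
    by (simp add: Qp_class_diff p)
  hence "padic_norm p (x \<ominus>\<^bsub>Qp p\<^esub> padic_class p (\<lambda>n. s N)) \<le> e"
    by (rule LIMSEQ_le_const2) (use N in \<open>auto intro!: exI[of _ N] less_imp_le\<close>)
  thus ?thesis by (rule that)
qed

theorem Qp_field: "field (Qp p)"
proof -
  interpret Q: cring "Qp p" by (rule Qp_cring)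
  show ?thesis
  proof (rule Q.cring_fieldI2)
    have "padic_norm p \<one>\<^bsub>Qp p\<^esub> \<noteq> 0" by (simp add: Qp_one padic_norm_const p)
    thus "\<zero>\<^bsub>Qp p\<^esub> \<noteq> \<one>\<^bsub>Qp p\<^esub>" using padic_norm_eq_0_iff[of "\<one>\<^bsub>Qp p\<^esub>"] by auto
  next
    fix x assume x: "x \<in> carrier (Qp p)" "x \<noteq> \<zero>\<^bsub>Qp p\<^esub>"
    obtain s where s: "padic_cauchy p s" "x = padic_class p s" using x(1) by (rule Qp_cases)
    define c where "c = padic_norm p x / 2"
    have c: "c > 0" using x padic_norm_nonneg[of x] padic_norm_eq_0_iff[of x] by (simp add: c_def)
    have "eventually (\<lambda>n. rat_padic_norm p (s n) > c) sequentially"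
      using padic_norm_class[OF s(1)] c by (intro order_tendstoD(1)) (auto simp: s c_def)
    then obtain N where N: "\<And>n. n \<ge> N \<Longrightarrow> rat_padic_norm p (s n) > c"
      by (auto simp: eventually_sequentially)
    have nz: "s n \<noteq> 0" if "n \<ge> N" for n using N[OF that] c by auto
    have cau: "padic_cauchy p (\<lambda>n. inverse (s n))"
      unfolding padic_cauchy_def
    proof (intro allI impI)
      fix e :: real assume e: "e > 0"
      hence "e * (c * c) > 0" using c by simp
      then obtain M where M: "\<forall>m\<ge>M. \<forall>n\<ge>M. rat_padic_norm p (s m - s n) < e * (c * c)"
        using s(1) unfolding padic_cauchy_def by meson
      have "rat_padic_norm p (inverse (s m) - inverse (s n)) < e" if mn: "m \<ge> max M N" "n \<ge> max M N" for m n
      proof -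
        have z: "s m \<noteq> 0" "s n \<noteq> 0" using nz mn by auto
        have "(inverse (s m) - inverse (s n)) * (s m * s n) = s n - s m"
          using z by (simp add: field_simps)
        hence "rat_padic_norm p (inverse (s m) - inverse (s n)) * (rat_padic_norm p (s m) * rat_padic_norm p (s n)) = rat_padic_norm p (s n - s m)"
          by (metis rat_padic_norm_mult[OF p])
        also have "\<dots> < e * (c * c)" using M mn by simp
        also have "\<dots> \<le> e * (rat_padic_norm p (s m) * rat_padic_norm p (s n))"
          using N[of m] N[of n] mn c e by (intro mult_left_mono mult_mono) auto
        finally show ?thesis
          by (metis mult_less_cancel_right_disj mult_nonneg_nonneg not_le rat_padic_norm_nonneg[OF p])
      qed
      thus "\<exists>N. \<forall>m\<ge>N. \<forall>n\<ge>N. rat_padic_norm p (inverse (s m) - inverse (s n)) < e" by blast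
    qed
    have "(\<lambda>n. s n * inverse (s n) - 1) \<in> padic_null p"
      unfolding padic_null_def mem_Collect_eq
      by (rule tendsto_eventually) (use nz in \<open>auto simp: eventually_sequentially intro!: exI[of _ N]\<close>)
    hence "x \<otimes>\<^bsub>Qp p\<^esub> padic_class p (\<lambda>n. inverse (s n)) = \<one>\<^bsub>Qp p\<^esub>"
      using s cau by (simp add: Qp_class_mult Qp_one padic_class_eq_iff)
    thus "\<exists>y\<in>carrier (Qp p). x \<otimes>\<^bsub>Qp p\<^esub> y = \<one>\<^bsub>Qp p\<^esub>" using cau padic_class_in_carrier by blast
  qed
qed

end

section \<open>Borel sets and Haar measure\<close>

definition padic_open :: "nat \<Rightarrow> (nat \<Rightarrow> rat) set set \<Rightarrow> bool" where
  "padic_open p U \<longleftrightarrow> U \<subseteq> carrier (Qp p) \<and>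
     (\<forall>x\<in>U. \<exists>e>0. \<forall>y\<in>carrier (Qp p). padic_norm p (y \<ominus>\<^bsub>Qp p\<^esub> x) < e \<longrightarrow> y \<in> U)"

definition padic_borel :: "nat \<Rightarrow> (nat \<Rightarrow> rat) set measure" where
  "padic_borel p = sigma (carrier (Qp p)) {U. padic_open p U}"

definition is_padic_haar :: "nat \<Rightarrow> (nat \<Rightarrow> rat) set measure \<Rightarrow> bool" where
  "is_padic_haar p M \<longleftrightarrow>
     sets M = sets (padic_borel p) \<and>
     (\<forall>a\<in>carrier (Qp p). \<forall>A\<in>sets M. emeasure M ((\<lambda>x. a \<oplus>\<^bsub>Qp p\<^esub> x) ` A) = emeasure M A) \<and>
     emeasure M {x \<in> carrier (Qp p). padic_norm p x \<le> 1} = 1"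

definition padic_haar :: "nat \<Rightarrow> (nat \<Rightarrow> rat) set measure" where
  "padic_haar p = (THE M. is_padic_haar p M)"

text \<open>To see that \<^const>\<open>padic_haar\<close> is well-defined, every ball of radius \<open>p^(-n)\<close> is written
  as a cell around \<open>p^n * padic_frac p m\<close> for a unique natural number \<open>m\<close>. Sending a real
  \<open>t \<ge> 0\<close> to the p-adic number with the reversed digit sequence then transports
  Lebesgue measure to Haar measure.\<close>

fun padic_frac :: "nat \<Rightarrow> nat \<Rightarrow> rat" where
  "padic_frac p m = (if p < 2 \<or> m = 0 then 0
     else (of_nat (m mod p) + padic_frac p (m div p)) / of_nat p)"

declare padic_frac.simps [simp del]

definition padic_centre :: "nat \<Rightarrow> nat \<Rightarrow> nat \<Rightarrow> (nat \<Rightarrow> rat) set" where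
  "padic_centre p n m = padic_class p (\<lambda>_. of_nat p ^ n * padic_frac p m)"

definition padic_cell :: "nat \<Rightarrow> nat \<Rightarrow> nat \<Rightarrow> (nat \<Rightarrow> rat) set set" where
  "padic_cell p n m =
     {x \<in> carrier (Qp p). padic_norm p (x \<ominus>\<^bsub>Qp p\<^esub> padic_centre p n m) \<le> 1 / real p ^ n}"

context
  fixes p :: nat
  assumes p: "prime p"
begin

interpretation Q: cring "Qp p" by (rule Qp_cring[OF p])

lemma p_gt_1: "real p > 1"
  using p prime_gt_1_nat by auto

lemma padic_frac_rec:
  "padic_frac p m = (of_nat (m mod p) + padic_frac p (m div p)) / of_nat p"
proof (cases "m = 0")
  case True
  thus ?thesis by (simp add: padic_frac.simps)
next
  case False
  moreover have "\<not> p < 2" using prime_ge_2_nat[OF p] by linarith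
  ultimately have "\<not> (p < 2 \<or> m = 0)" by simp
  thus ?thesis by (subst padic_frac.simps) (simp only: if_False)
qed

lemma padic_frac_step:
  "of_nat p ^ Suc n * padic_frac p m = of_nat p ^ n * of_nat (m mod p) + of_nat p ^ n * padic_frac p (m div p)"
proof -
  have "(of_nat p :: rat) \<noteq> 0" using p by (simp add: prime_gt_0_nat)
  thus ?thesis by (subst padic_frac_rec) (simp add: field_simps)
qed

lemma rat_padic_norm_of_nat_le_1: "rat_padic_norm p (of_nat a) \<le> 1"
  using rat_padic_norm_of_int_le_1[OF p, of "int a"] by simp

lemma rat_padic_norm_p_times_le:
  "rat_padic_norm p z \<le> 1 \<longleftrightarrow> rat_padic_norm p (of_nat p * z) \<le> 1 / real p"
  using p_gt_1 by (simp add: rat_padic_norm_mult[OF p] rat_padic_norm_p[OF p] field_simps)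

lemma padic_frac_unique:
  "rat_padic_norm p (padic_frac p m - padic_frac p k) \<le> 1 \<Longrightarrow> m = k"
proof (induction "m + k" arbitrary: m k rule: less_induct)
  case less
  show ?case
  proof (cases "m = 0 \<and> k = 0")
    case False
    define a b where "a = m div p" and "b = k div p"
    define z where "z = padic_frac p a - padic_frac p b"
    define d where "d = int (m mod p) - int (k mod p)"
    have "p > 1" using p prime_gt_1_nat by blast
    hence small: "a + b < m + k" using False unfolding a_def b_def
      by (metis add_less_le_mono add_le_less_mono add_is_0 div_le_dividend div_less_dividend neq0_conv)
    have pz: "(of_nat p :: rat) \<noteq> 0" using p by (simp add: prime_gt_0_nat)
    have e: "of_nat p * (padic_frac p m - padic_frac p k) = of_int d + z"
      using pz by (subst (1 2) padic_frac_rec) (simp add: a_def b_def z_def d_def field_simps)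
    have le: "rat_padic_norm p (of_int d + z) \<le> 1 / real p"
      using less.prems e rat_padic_norm_p_times_le by metis
    have "rat_padic_norm p (of_int d + z - of_int d) \<le> 1"
      using rat_padic_norm_diff[OF p, of "of_int d + z" "of_int d"] le
        rat_padic_norm_of_int_le_1[OF p, of d] p_gt_1
      by (smt (verit) divide_le_eq_1)
    hence "rat_padic_norm p z \<le> 1" by simp
    hence ab: "a = b" using less.hyps[OF small] by (simp add: z_def)
    hence "rat_padic_norm p (of_int d) \<le> real p powi (- int 1)"
      using le by (simp add: z_def power_int_minus inverse_eq_divide)
    hence "int p dvd d" using rat_padic_norm_of_int_le[OF p, of d 1] by simp
    moreover have "\<bar>d\<bar> < int p"
    proof -
      have "m mod p < p" "k mod p < p" using \<open>p > 1\<close> by auto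
      hence "int (m mod p) < int p" "int (k mod p) < int p" by linarith+
      thus ?thesis unfolding d_def by linarith
    qed
    ultimately have "d = 0" using zdvd_imp_le[of "int p" "\<bar>d\<bar>"] by fastforce
    hence "m mod p = k mod p" by (simp add: d_def)
    thus ?thesis using ab unfolding a_def b_def by (metis div_mult_mod_eq)
  qed simp
qed

lemma rat_padic_digit:
  assumes "rat_padic_norm p z \<le> 1"
  obtains d where "d < p" "rat_padic_norm p (z - of_nat d) \<le> 1 / real p"
proof -
  obtain a b where ab: "quotient_of z = (a, b)" by force
  have b: "b > 0" using quotient_of_denom_pos[OF ab] .
  have z: "z = of_int a / of_int b" using quotient_of_div[OF ab] .
  have cop: "coprime a b" using quotient_of_coprime[OF ab] .
  have dv: "rat_padic_norm p (of_int x) \<le> 1 / real p \<longleftrightarrow> int p dvd x" for x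
    using rat_padic_norm_of_int_le[OF p, of x 1] by (simp add: power_int_minus inverse_eq_divide)
  have "z * of_int b = of_int a" using b z by simp
  hence "rat_padic_norm p (of_int a) = rat_padic_norm p z * rat_padic_norm p (of_int b)"
    by (metis rat_padic_norm_mult[OF p])
  also have "\<dots> \<le> 1 * rat_padic_norm p (of_int b)"
    using assms by (intro mult_right_mono) (auto simp: p)
  finally have leb: "rat_padic_norm p (of_int a) \<le> rat_padic_norm p (of_int b)" by simp
  have pb: "\<not> int p dvd b"
  proof
    assume *: "int p dvd b"
    hence "rat_padic_norm p (of_int a) \<le> 1 / real p" using dv leb by (meson order_trans)
    hence "int p dvd a" using dv by blast
    with * cop have "is_unit (int p)" using coprime_common_divisor by blast
    thus False using p by (simp add: prime_int_iff)
  qed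
  hence nb: "rat_padic_norm p (of_int b) = 1"
    using rat_padic_norm_frac[OF p, of b 1] b by (simp add: not_dvd_imp_multiplicity_0)
  have "coprime (int p) b" using p pb by (simp add: prime_imp_coprime)
  then obtain u v where uv: "u * b + v * int p = 1"
    using bezout_int[of b "int p"] by (metis coprime_iff_gcd_eq_1 gcd.commute)
  define d where "d = (a * u) mod int p"
  have p0: "int p > 0" using p by (simp add: prime_gt_0_nat)
  have d: "0 \<le> d" "d < int p" using p0 by (auto simp: d_def)
  have "d = a * u - int p * ((a * u) div int p)"
    unfolding d_def by (simp add: minus_mult_div_eq_mod)
  hence "d * b = a * u * b - int p * (((a * u) div int p) * b)"
    by (metis left_diff_distrib mult.assoc)
  hence "a - d * b = a * (1 - u * b) + int p * (((a * u) div int p) * b)"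
    by (simp add: algebra_simps)
  also have "1 - u * b = v * int p" using uv by simp
  finally have "int p dvd a - d * b" by simp
  hence "rat_padic_norm p (of_int (a - d * b)) \<le> 1 / real p" using dv by blast
  moreover have "of_int (a - d * b) = (z - of_int d) * of_int b" using z b by (simp add: field_simps)
  ultimately have "rat_padic_norm p (z - of_int d) \<le> 1 / real p"
    by (simp add: rat_padic_norm_mult[OF p] nb)
  thus ?thesis using d that[of "nat d"] by auto
qed

lemma padic_frac_exists: "\<exists>m. rat_padic_norm p (q - padic_frac p m) \<le> 1"
proof -
  have *: "\<exists>m. rat_padic_norm p (q - padic_frac p m) \<le> 1" if "rat_padic_norm p q \<le> real p ^ k" for q k
    using that
  proof (induction k arbitrary: q)
    case 0
    thus ?case by (intro exI[of _ 0]) (simp add: padic_frac.simps)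
  next
    case (Suc k)
    have pz: "(of_nat p :: rat) \<noteq> 0" using p by (simp add: prime_gt_0_nat)
    have "rat_padic_norm p (of_nat p * q) \<le> real p ^ k"
      using Suc.prems p_gt_1 by (simp add: rat_padic_norm_mult[OF p] rat_padic_norm_p[OF p] field_simps)
    then obtain m where "rat_padic_norm p (of_nat p * q - padic_frac p m) \<le> 1" using Suc.IH by blast
    then obtain d where d: "d < p" "rat_padic_norm p (of_nat p * q - padic_frac p m - of_nat d) \<le> 1 / real p"
      using rat_padic_digit by metis
    have dm: "(m * p + d) mod p = d" "(m * p + d) div p = m" using d(1) by auto
    have "of_nat p * q - padic_frac p m - of_nat d = of_nat p * (q - padic_frac p (m * p + d))"
      using pz by (subst (2) padic_frac_rec) (simp only: dm, simp add: field_simps)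
    thus ?case using d rat_padic_norm_p_times_le by metis
  qed
  obtain k where "rat_padic_norm p q < real p ^ k" using real_arch_pow[OF p_gt_1] by blast
  thus ?thesis using * less_imp_le by blast
qed

lemma padic_centre_closed [simp]: "padic_centre p n m \<in> carrier (Qp p)"
  by (simp add: padic_centre_def padic_class_in_carrier p)

lemma padic_norm_const_diff:
  "padic_norm p (padic_class p (\<lambda>_. q) \<ominus>\<^bsub>Qp p\<^esub> padic_class p (\<lambda>_. r)) = rat_padic_norm p (q - r)"
  by (simp add: Qp_class_diff p padic_norm_const)

lemma rat_padic_norm_scale_le:
  "rat_padic_norm p (of_nat p ^ n * z) \<le> 1 / real p ^ n \<longleftrightarrow> rat_padic_norm p z \<le> 1"
  using p_gt_1 by (simp add: rat_padic_norm_mult[OF p] rat_padic_norm_p_power[OF p] divide_le_cancel)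

lemma padic_cell_exists:
  assumes "x \<in> carrier (Qp p)"
  shows "\<exists>m. x \<in> padic_cell p n m"
proof -
  have "1 / real p ^ n > 0" using p_gt_1 by simp
  then obtain q where q: "padic_norm p (x \<ominus>\<^bsub>Qp p\<^esub> padic_class p (\<lambda>_. q)) \<le> 1 / real p ^ n"
    using padic_rat_dense[OF p assms] by blast
  obtain m where m: "rat_padic_norm p (q / of_nat p ^ n - padic_frac p m) \<le> 1"
    using padic_frac_exists by blast
  have "of_nat p ^ n * (q / of_nat p ^ n - padic_frac p m) = q - of_nat p ^ n * padic_frac p m"
    using p by (simp add: field_simps prime_gt_0_nat)
  hence "rat_padic_norm p (q - of_nat p ^ n * padic_frac p m) \<le> 1 / real p ^ n"
    using m rat_padic_norm_scale_le by metis
  hence "padic_norm p (padic_class p (\<lambda>_. q) \<ominus>\<^bsub>Qp p\<^esub> padic_centre p n m) \<le> 1 / real p ^ n"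
    by (simp add: padic_centre_def padic_norm_const_diff)
  with q have "padic_norm p (x \<ominus>\<^bsub>Qp p\<^esub> padic_centre p n m) \<le> 1 / real p ^ n"
    using padic_norm_diff_trans[OF p assms, of "padic_class p (\<lambda>_. q)" "padic_centre p n m"]
    by (simp add: padic_class_in_carrier p)
  thus ?thesis using assms by (auto simp: padic_cell_def)
qed

lemma padic_cell_dist:
  assumes "x \<in> padic_cell p n m" "y \<in> padic_cell p n m"
  shows "padic_norm p (x \<ominus>\<^bsub>Qp p\<^esub> y) \<le> 1 / real p ^ n"
proof -
  have xy: "x \<in> carrier (Qp p)" "y \<in> carrier (Qp p)" using assms by (auto simp: padic_cell_def)
  show ?thesis
    using assms padic_norm_diff_trans[OF p xy(1) padic_centre_closed xy(2), of n m]
      padic_norm_diff_commute[OF p xy(2) padic_centre_closed, of n m]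
    by (auto simp: padic_cell_def)
qed

lemma padic_cell_closed_dist:
  assumes "x \<in> padic_cell p n m" "y \<in> carrier (Qp p)" "padic_norm p (y \<ominus>\<^bsub>Qp p\<^esub> x) \<le> 1 / real p ^ n"
  shows "y \<in> padic_cell p n m"
  using assms padic_norm_diff_trans[OF p assms(2) _ padic_centre_closed, of x n m]
  by (auto simp: padic_cell_def)

lemma padic_centre_in_cell: "padic_centre p n m \<in> padic_cell p n m"
proof -
  have "padic_norm p (padic_centre p n m \<ominus>\<^bsub>Qp p\<^esub> padic_centre p n m) = 0"
    by (simp add: padic_centre_def padic_norm_const_diff)
  thus ?thesis by (simp add: padic_cell_def)
qed

lemma padic_cell_unique:
  assumes "x \<in> padic_cell p n m" "x \<in> padic_cell p n k"
  shows "m = k"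
proof -
  have x: "x \<in> carrier (Qp p)" using assms by (auto simp: padic_cell_def)
  have "padic_norm p (padic_centre p n m \<ominus>\<^bsub>Qp p\<^esub> padic_centre p n k) \<le> 1 / real p ^ n"
    using assms padic_norm_diff_trans[OF p padic_centre_closed x padic_centre_closed, of n m n k]
      padic_norm_diff_commute[OF p x padic_centre_closed, of n m]
    by (auto simp: padic_cell_def)
  hence "rat_padic_norm p (of_nat p ^ n * (padic_frac p m - padic_frac p k)) \<le> 1 / real p ^ n"
    by (simp add: padic_centre_def padic_norm_const_diff right_diff_distrib)
  thus ?thesis using padic_frac_unique rat_padic_norm_scale_le by blast
qed

lemma padic_cell_Suc_subset: "padic_cell p (Suc n) m \<subseteq> padic_cell p n (m div p)"
proof
  fix x assume x: "x \<in> padic_cell p (Suc n) m"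
  hence xc: "x \<in> carrier (Qp p)" by (simp add: padic_cell_def)
  have "padic_norm p (padic_centre p (Suc n) m \<ominus>\<^bsub>Qp p\<^esub> padic_centre p n (m div p))
      = rat_padic_norm p (of_nat p ^ n * of_nat (m mod p))"
    unfolding padic_centre_def padic_norm_const_diff padic_frac_step by simp
  also have "\<dots> \<le> 1 / real p ^ n"
    using rat_padic_norm_scale_le rat_padic_norm_of_nat_le_1 by blast
  finally have c: "padic_centre p (Suc n) m \<in> padic_cell p n (m div p)"
    by (simp add: padic_cell_def)
  have "padic_norm p (x \<ominus>\<^bsub>Qp p\<^esub> padic_centre p (Suc n) m) \<le> 1 / real p ^ Suc n"
    using x by (simp add: padic_cell_def)
  also have "\<dots> \<le> 1 / real p ^ n" using p_gt_1 by (intro divide_left_mono power_increasing) auto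
  finally show "x \<in> padic_cell p n (m div p)" by (rule padic_cell_closed_dist[OF c xc])
qed

lemma padic_cell_add_subset: "padic_cell p (n + k) m \<subseteq> padic_cell p n (m div p ^ k)"
proof (induction k arbitrary: m)
  case (Suc k)
  have "padic_cell p (n + Suc k) m \<subseteq> padic_cell p (n + k) (m div p)"
    using padic_cell_Suc_subset[of "n + k" m] by simp
  also have "\<dots> \<subseteq> padic_cell p n (m div p div p ^ k)" by (rule Suc)
  finally show ?case by (simp add: div_mult2_eq)
qed simp

lemma padic_cell_split: "padic_cell p n k = (\<Union>d<p. padic_cell p (Suc n) (k * p + d))"
proof (intro equalityI subsetI)
  fix x assume x: "x \<in> padic_cell p n k"
  then obtain m where m: "x \<in> padic_cell p (Suc n) m"
    using padic_cell_exists[of x "Suc n"] unfolding padic_cell_def by blast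
  have k: "k = m div p" using padic_cell_unique[OF x] padic_cell_Suc_subset m by blast
  have "m = k * p + m mod p" "m mod p < p" using p by (auto simp: k prime_gt_0_nat)
  thus "x \<in> (\<Union>d<p. padic_cell p (Suc n) (k * p + d))" using m by (metis UN_I lessThan_iff)
next
  fix x assume "x \<in> (\<Union>d<p. padic_cell p (Suc n) (k * p + d))"
  then obtain d where d: "d < p" "x \<in> padic_cell p (Suc n) (k * p + d)" by auto
  have "(k * p + d) div p = k" using d by simp
  thus "x \<in> padic_cell p n k" using padic_cell_Suc_subset[of n "k * p + d"] d by auto
qed

lemma padic_cell_0: "padic_cell p 0 0 = {x \<in> carrier (Qp p). padic_norm p x \<le> 1}"
proof -
  have "padic_centre p 0 0 = \<zero>\<^bsub>Qp p\<^esub>" by (simp add: padic_centre_def padic_frac.simps Qp_zero p)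
  moreover have "x \<ominus>\<^bsub>Qp p\<^esub> \<zero>\<^bsub>Qp p\<^esub> = x" if "x \<in> carrier (Qp p)" for x
    using that by (simp add: a_minus_def)
  ultimately show ?thesis by (auto simp: padic_cell_def)
qed

lemma padic_cell_translate:
  assumes "a \<in> carrier (Qp p)" "a \<oplus>\<^bsub>Qp p\<^esub> padic_centre p n m \<in> padic_cell p n k"
  shows "(\<lambda>x. a \<oplus>\<^bsub>Qp p\<^esub> x) ` padic_cell p n m = padic_cell p n k"
proof (intro equalityI subsetI)
  fix y assume "y \<in> (\<lambda>x. a \<oplus>\<^bsub>Qp p\<^esub> x) ` padic_cell p n m"
  then obtain x where x: "x \<in> padic_cell p n m" "y = a \<oplus>\<^bsub>Qp p\<^esub> x" by blast
  have xc: "x \<in> carrier (Qp p)" using x by (simp add: padic_cell_def)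
  have e: "y \<ominus>\<^bsub>Qp p\<^esub> (a \<oplus>\<^bsub>Qp p\<^esub> padic_centre p n m) = x \<ominus>\<^bsub>Qp p\<^esub> padic_centre p n m"
    unfolding x(2) using assms(1) xc padic_centre_closed by algebra
  show "y \<in> padic_cell p n k"
    by (rule padic_cell_closed_dist[OF assms(2)]) (use x xc assms e in \<open>auto simp: padic_cell_def\<close>)
next
  fix y assume y: "y \<in> padic_cell p n k"
  hence yc: "y \<in> carrier (Qp p)" by (simp add: padic_cell_def)
  define x where "x = y \<ominus>\<^bsub>Qp p\<^esub> a"
  have xc: "x \<in> carrier (Qp p)" using yc assms by (simp add: x_def)
  have "x \<ominus>\<^bsub>Qp p\<^esub> padic_centre p n m = y \<ominus>\<^bsub>Qp p\<^esub> (a \<oplus>\<^bsub>Qp p\<^esub> padic_centre p n m)"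
    unfolding x_def using assms(1) yc padic_centre_closed by algebra
  hence "x \<in> padic_cell p n m" using padic_cell_dist[OF y assms(2)] xc by (simp add: padic_cell_def)
  moreover have "y = a \<oplus>\<^bsub>Qp p\<^esub> x" unfolding x_def using assms(1) yc by algebra
  ultimately show "y \<in> (\<lambda>x. a \<oplus>\<^bsub>Qp p\<^esub> x) ` padic_cell p n m" by blast
qed

lemma padic_cell_translate_ex:
  assumes "a \<in> carrier (Qp p)"
  shows "\<exists>k. (\<lambda>x. a \<oplus>\<^bsub>Qp p\<^esub> x) ` padic_cell p n m = padic_cell p n k"
  using padic_cell_translate[OF assms] padic_cell_exists[of "a \<oplus>\<^bsub>Qp p\<^esub> padic_centre p n m" n] assms
  by (meson Q.add.m_closed padic_centre_closed)

lemma padic_open_cell: "padic_open p (padic_cell p n m)"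
  unfolding padic_open_def
proof (intro conjI ballI)
  show "padic_cell p n m \<subseteq> carrier (Qp p)" by (auto simp: padic_cell_def)
  fix x assume "x \<in> padic_cell p n m"
  thus "\<exists>e>0. \<forall>y\<in>carrier (Qp p). padic_norm p (y \<ominus>\<^bsub>Qp p\<^esub> x) < e \<longrightarrow> y \<in> padic_cell p n m"
    using p_gt_1 by (intro exI[of _ "1 / real p ^ n"]) (auto intro: padic_cell_closed_dist)
qed

lemma padic_open_Union_cells:
  assumes "padic_open p U"
  shows "U = (\<Union>(n, m)\<in>{(n, m). padic_cell p n m \<subseteq> U}. padic_cell p n m)"
proof (intro equalityI subsetI)
  fix x assume x: "x \<in> U"
  have xc: "x \<in> carrier (Qp p)" using x assms by (auto simp: padic_open_def)
  obtain e where e: "e > 0" "\<And>y. y \<in> carrier (Qp p) \<Longrightarrow> padic_norm p (y \<ominus>\<^bsub>Qp p\<^esub> x) < e \<Longrightarrow> y \<in> U"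
    using x assms by (auto simp: padic_open_def)
  obtain n where n: "1 / real p ^ n < e"
  proof -
    have "1 / real p < 1" using p_gt_1 by simp
    then obtain n where "(1 / real p) ^ n < e" using real_arch_pow_inv e(1) by blast
    thus ?thesis using that by (simp add: power_one_over)
  qed
  obtain m where m: "x \<in> padic_cell p n m" using padic_cell_exists[OF xc] by blast
  have "padic_cell p n m \<subseteq> U"
  proof
    fix y assume y: "y \<in> padic_cell p n m"
    hence "padic_norm p (y \<ominus>\<^bsub>Qp p\<^esub> x) < e" using padic_cell_dist[OF y m] n by linarith
    thus "y \<in> U" using e(2) y by (auto simp: padic_cell_def)
  qed
  thus "x \<in> (\<Union>(n, m)\<in>{(n, m). padic_cell p n m \<subseteq> U}. padic_cell p n m)" using m by blast
qed auto

definition padic_cells :: "(nat \<Rightarrow> rat) set set set" where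
  "padic_cells = insert {} (range (\<lambda>(n, m). padic_cell p n m))"

lemma padic_cells_subset: "padic_cells \<subseteq> Pow (carrier (Qp p))"
  by (auto simp: padic_cells_def padic_cell_def)

lemma space_padic_borel [simp]: "space (padic_borel p) = carrier (Qp p)"
  unfolding padic_borel_def by (rule space_measure_of) (auto simp: padic_open_def)

lemma sets_padic_borel: "sets (padic_borel p) = sigma_sets (carrier (Qp p)) padic_cells"
proof -
  have "sets (padic_borel p) = sigma_sets (carrier (Qp p)) {U. padic_open p U}"
    unfolding padic_borel_def by (rule sets_measure_of) (auto simp: padic_open_def)
  also have "\<dots> = sigma_sets (carrier (Qp p)) padic_cells"
  proof (rule sigma_sets_eqI)
    fix U assume "U \<in> {U. padic_open p U}"
    hence U: "padic_open p U" by simp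
    interpret S: sigma_algebra "carrier (Qp p)" "sigma_sets (carrier (Qp p)) padic_cells"
      by (rule sigma_algebra_sigma_sets[OF padic_cells_subset])
    have "(\<Union>(n, m)\<in>{(n, m). padic_cell p n m \<subseteq> U}. padic_cell p n m) \<in> sigma_sets (carrier (Qp p)) padic_cells"
      by (rule S.countable_UN') (auto simp: padic_cells_def intro!: sigma_sets.Basic)
    thus "U \<in> sigma_sets (carrier (Qp p)) padic_cells" using padic_open_Union_cells[OF U] by simp
  next
    fix U assume "U \<in> padic_cells"
    thus "U \<in> sigma_sets (carrier (Qp p)) {U. padic_open p U}"
      by (auto simp: padic_cells_def padic_open_cell intro: sigma_sets.intros)
  qed
  finally show ?thesis .
qed

lemma padic_cells_Int_stable: "Int_stable padic_cells"
proof -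
  have *: "padic_cell p n m \<inter> padic_cell p (n + d) k \<in> padic_cells" for n m d k
  proof (cases "padic_cell p n m \<inter> padic_cell p (n + d) k = {}")
    case False
    then obtain x where x: "x \<in> padic_cell p n m" "x \<in> padic_cell p (n + d) k" by blast
    have "m = k div p ^ d" using padic_cell_unique[OF x(1)] padic_cell_add_subset x(2) by blast
    hence "padic_cell p n m \<inter> padic_cell p (n + d) k = padic_cell p (n + d) k"
      using padic_cell_add_subset by blast
    thus ?thesis by (auto simp: padic_cells_def)
  qed (auto simp: padic_cells_def)
  have "padic_cell p n m \<inter> padic_cell p n' k \<in> padic_cells" for n m n' k
  proof (cases "n \<le> n'")
    case True
    thus ?thesis using *[of n m "n' - n" k] by simp
  next
    case False
    thus ?thesis using *[of n' k "n - n'" m] by (simp add: Int_commute)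
  qed
  thus ?thesis unfolding Int_stable_def padic_cells_def by auto
qed

lemma padic_cell_in_borel: "padic_cell p n m \<in> sets (padic_borel p)"
  unfolding sets_padic_borel by (auto simp: padic_cells_def intro!: sigma_sets.Basic)

lemma padic_measure_eqI:
  assumes "sets M = sets (padic_borel p)" "sets N = sets (padic_borel p)"
    and "\<And>n m. emeasure M (padic_cell p n m) = 1 / ennreal (real p ^ n)"
    and "\<And>n m. emeasure N (padic_cell p n m) = 1 / ennreal (real p ^ n)"
  shows "M = N"
proof (rule measure_eqI_generator_eq[OF padic_cells_Int_stable padic_cells_subset,
      where A = "\<lambda>m. padic_cell p 0 m"])
  show "sets M = sigma_sets (carrier (Qp p)) padic_cells" "sets N = sigma_sets (carrier (Qp p)) padic_cells"
    using assms sets_padic_borel by auto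
  show "emeasure M X = emeasure N X" if "X \<in> padic_cells" for X
    using that assms by (auto simp: padic_cells_def)
  show "range (padic_cell p 0) \<subseteq> padic_cells" by (auto simp: padic_cells_def)
  show "(\<Union>i. padic_cell p 0 i) = carrier (Qp p)"
    using padic_cell_exists[of _ 0] by (auto simp: padic_cell_def)
  show "emeasure M (padic_cell p 0 i) \<noteq> \<infinity>" for i using assms(3)[of 0 i] by simp
qed

lemma padic_haar_cell:
  assumes "is_padic_haar p M"
  shows "emeasure M (padic_cell p n m) = 1 / ennreal (real p ^ n)"
proof -
  have cs: "padic_cell p n m \<in> sets M" for n m
    using assms padic_cell_in_borel by (simp add: is_padic_haar_def)
  have same: "emeasure M (padic_cell p n m) = emeasure M (padic_cell p n k)" for n m k
  proof -
    define a where "a = padic_centre p n k \<ominus>\<^bsub>Qp p\<^esub> padic_centre p n m"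
    have a: "a \<in> carrier (Qp p)" by (simp add: a_def)
    have "a \<oplus>\<^bsub>Qp p\<^esub> padic_centre p n m = padic_centre p n k"
      unfolding a_def using padic_centre_closed[of n k] padic_centre_closed[of n m] by algebra
    hence "(\<lambda>x. a \<oplus>\<^bsub>Qp p\<^esub> x) ` padic_cell p n m = padic_cell p n k"
      using padic_cell_translate[OF a] padic_centre_in_cell by simp
    thus ?thesis using assms a cs unfolding is_padic_haar_def by metis
  qed
  show ?thesis
  proof (induction n arbitrary: m)
    case 0
    have "emeasure M (padic_cell p 0 0) = 1" using assms by (simp add: is_padic_haar_def padic_cell_0)
    thus ?case using same[of 0 m 0] by simp
  next
    case (Suc n)
    have "emeasure M (padic_cell p n 0) = emeasure M (\<Union>d<p. padic_cell p (Suc n) d)"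
      using padic_cell_split[of n 0] by simp
    also have "\<dots> = (\<Sum>d<p. emeasure M (padic_cell p (Suc n) d))"
      by (rule sum_emeasure[symmetric])
        (auto simp: cs disjoint_family_on_def dest: padic_cell_unique)
    also have "\<dots> = (\<Sum>d<p. emeasure M (padic_cell p (Suc n) m))"
      by (intro sum.cong refl same)
    also have "\<dots> = ennreal (real p) * emeasure M (padic_cell p (Suc n) m)"
      by (simp add: ennreal_of_nat_eq_real_of_nat)
    finally have "ennreal (real p) * emeasure M (padic_cell p (Suc n) m) = 1 / ennreal (real p ^ n)"
      using Suc.IH by simp
    also have "1 / ennreal (real p ^ n) = ennreal (real p) * (1 / ennreal (real p ^ Suc n))"
    proof -
      have "1 / ennreal (real p ^ k) = ennreal (1 / real p ^ k)" for k
        using p_gt_1 by (simp add: divide_ennreal flip: ennreal_1)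
      moreover have "ennreal (real p) * ennreal (1 / real p ^ Suc n) = ennreal (1 / real p ^ n)"
        using p_gt_1 by (subst ennreal_mult[symmetric]) auto
      ultimately show ?thesis by (simp only:)
    qed
    finally show ?case
      using p_gt_1 by (subst (asm) ennreal_mult_cancel_left) auto
  qed
qed

lemma is_padic_haar_unique: "is_padic_haar p M \<Longrightarrow> is_padic_haar p N \<Longrightarrow> M = N"
  by (rule padic_measure_eqI) (auto simp: padic_haar_cell, auto simp: is_padic_haar_def)

definition padic_of_real :: "real \<Rightarrow> (nat \<Rightarrow> rat) set" where
  "padic_of_real t = padic_class p (\<lambda>n. of_nat p ^ n * padic_frac p (nat \<lfloor>t * real p ^ n\<rfloor>))"

lemma padic_of_real_cell:
  assumes "t \<ge> 0"
  shows "padic_of_real t \<in> padic_cell p n (nat \<lfloor>t * real p ^ n\<rfloor>)"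
proof -
  define f where "f n = nat \<lfloor>t * real p ^ n\<rfloor>" for n
  define s where "s n = of_nat p ^ n * padic_frac p (f n)" for n
  have f: "f (Suc n) div p = f n" for n
  proof -
    have "\<lfloor>t * real p ^ n\<rfloor> = \<lfloor>(t * real p ^ Suc n) / real_of_int (int p)\<rfloor>" using p_gt_1 by simp
    also have "\<dots> = \<lfloor>t * real p ^ Suc n\<rfloor> div int p" by (rule floor_divide_real_eq_div) simp
    finally show ?thesis using assms by (simp add: f_def nat_div_distrib)
  qed
  have step: "rat_padic_norm p (s (Suc n) - s n) \<le> 1 / real p ^ n" for n
  proof -
    have "s (Suc n) - s n = of_nat p ^ n * of_nat (f (Suc n) mod p)"
      unfolding s_def padic_frac_step f by simp
    thus ?thesis using rat_padic_norm_scale_le rat_padic_norm_of_nat_le_1 by simp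
  qed
  have far: "rat_padic_norm p (s (n + k) - s n) \<le> 1 / real p ^ n" for n k
  proof (induction k)
    case (Suc k)
    have "rat_padic_norm p (s (n + Suc k) - s (n + k)) \<le> 1 / real p ^ (n + k)" using step[of "n + k"] by simp
    also have "\<dots> \<le> 1 / real p ^ n" using p_gt_1 by (intro divide_left_mono power_increasing) auto
    finally show ?case
      using Suc rat_padic_norm_add[OF p, of "s (n + Suc k) - s (n + k)" "s (n + k) - s n"] by simp
  qed simp
  have far': "rat_padic_norm p (s m - s n) \<le> 1 / real p ^ n" if "m \<ge> n" for m n
    using far[of n "m - n"] that by simp
  have cau: "padic_cauchy p s"
    unfolding padic_cauchy_def
  proof (intro allI impI)
    fix e :: real assume e: "e > 0"
    have "1 / real p < 1" using p_gt_1 by simp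
    then obtain N where "(1 / real p) ^ N < e" using real_arch_pow_inv e by blast
    hence N: "1 / real p ^ N < e" by (simp add: power_one_over)
    have "rat_padic_norm p (s m - s n) < e" if "m \<ge> N" "n \<ge> N" for m n
    proof -
      have "rat_padic_norm p ((s m - s N) - (s n - s N)) < e"
        using rat_padic_norm_diff[OF p, of "s m - s N" "s n - s N"] far'[OF that(1)] far'[OF that(2)] N
        by linarith
      thus ?thesis by simp
    qed
    thus "\<exists>N. \<forall>m\<ge>N. \<forall>n\<ge>N. rat_padic_norm p (s m - s n) < e" by blast
  qed
  have g: "padic_of_real t = padic_class p s" 
    unfolding padic_of_real_def s_def[abs_def] f_def ..
  have "(\<lambda>k. rat_padic_norm p (s k - s n)) \<longlonglongrightarrow> padic_norm p (padic_class p s \<ominus>\<^bsub>Qp p\<^esub> padic_class p (\<lambda>_. s n))"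
    using padic_norm_class[OF p padic_cauchy_diff[OF p cau padic_cauchy_const[OF p]]] cau
    by (simp add: Qp_class_diff p)
  hence "padic_norm p (padic_class p s \<ominus>\<^bsub>Qp p\<^esub> padic_class p (\<lambda>_. s n)) \<le> 1 / real p ^ n"
    by (rule LIMSEQ_le_const2) (use far' in blast)
  thus ?thesis using cau by (simp add: padic_cell_def g padic_centre_def s_def f_def padic_class_in_carrier p)
qed

lemma padic_of_real_cell_iff:
  assumes "t \<ge> 0"
  shows "padic_of_real t \<in> padic_cell p n m \<longleftrightarrow> real m / real p ^ n \<le> t \<and> t < (real m + 1) / real p ^ n"
proof -
  have "padic_of_real t \<in> padic_cell p n m \<longleftrightarrow> nat \<lfloor>t * real p ^ n\<rfloor> = m"
    using padic_of_real_cell[OF assms, of n] padic_cell_unique by blast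
  also have "\<dots> \<longleftrightarrow> \<lfloor>t * real p ^ n\<rfloor> = int m" using assms by (simp add: nat_eq_iff)
  also have "\<dots> \<longleftrightarrow> real m \<le> t * real p ^ n \<and> t * real p ^ n < real m + 1"
    by (simp add: floor_eq_iff)
  also have "\<dots> \<longleftrightarrow> real m / real p ^ n \<le> t \<and> t < (real m + 1) / real p ^ n"
    using p_gt_1 by (simp add: field_simps)
  finally show ?thesis .
qed

lemma padic_of_real_vimage:
  "padic_of_real -` padic_cell p n m \<inter> {0..} = {real m / real p ^ n ..< (real m + 1) / real p ^ n}"
proof -
  have "t \<ge> 0" if "real m / real p ^ n \<le> t" for t
    using that order_trans[of 0 "real m / real p ^ n" t] by simp
  thus ?thesis using padic_of_real_cell_iff by auto
qed

lemma padic_of_real_measurable: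
  "padic_of_real \<in> restrict_space lborel {0..} \<rightarrow>\<^sub>M padic_borel p"
proof (rule measurable_sigma_sets[OF sets_padic_borel padic_cells_subset])
  show "padic_of_real \<in> space (restrict_space lborel {0..}) \<rightarrow> carrier (Qp p)"
    using padic_of_real_cell[of _ 0] by (auto simp: space_restrict_space padic_cell_def)
  fix A assume "A \<in> padic_cells"
  then consider "A = {}" | n m where "A = padic_cell p n m" by (auto simp: padic_cells_def)
  thus "padic_of_real -` A \<inter> space (restrict_space lborel {0..}) \<in> sets (restrict_space lborel {0..})"
  proof cases
    case 2
    have "{real m / real p ^ n ..< (real m + 1) / real p ^ n} \<subseteq> {0..}"
      using padic_of_real_vimage by blast
    thus ?thesis using 2
      by (simp add: space_restrict_space padic_of_real_vimage sets_restrict_space_iff)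
  qed simp
qed

lemma padic_haar_exists: "\<exists>M. is_padic_haar p M"
proof -
  define M where "M = distr (restrict_space lborel {0..}) (padic_borel p) padic_of_real"
  have sM: "sets M = sets (padic_borel p)" by (simp add: M_def)
  have spM: "space M = carrier (Qp p)" by (simp add: M_def)
  have cell: "emeasure M (padic_cell p n m) = 1 / ennreal (real p ^ n)" for n m
  proof -
    have "emeasure M (padic_cell p n m) =
        emeasure (restrict_space lborel {0..}) {real m / real p ^ n ..< (real m + 1) / real p ^ n}"
      unfolding M_def by (subst emeasure_distr[OF padic_of_real_measurable padic_cell_in_borel])
        (simp add: space_restrict_space padic_of_real_vimage)
    also have "\<dots> = emeasure lborel {real m / real p ^ n ..< (real m + 1) / real p ^ n}"
      using padic_of_real_vimage[of n m] by (intro emeasure_restrict_space) auto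
    also have "\<dots> = ennreal ((real m + 1) / real p ^ n - real m / real p ^ n)"
      using p_gt_1 by (intro emeasure_lborel_Ico) (simp add: divide_right_mono)
    also have "(real m + 1) / real p ^ n - real m / real p ^ n = 1 / real p ^ n"
      by (simp add: add_divide_distrib)
    also have "ennreal (1 / real p ^ n) = 1 / ennreal (real p ^ n)"
      using p_gt_1 by (simp add: divide_ennreal flip: ennreal_1)
    finally show ?thesis .
  qed
  have trans: "emeasure M ((\<lambda>x. a \<oplus>\<^bsub>Qp p\<^esub> x) ` A) = emeasure M A"
    if a: "a \<in> carrier (Qp p)" and A: "A \<in> sets M" for a A
  proof -
    define T where "T x = (\<ominus>\<^bsub>Qp p\<^esub> a) \<oplus>\<^bsub>Qp p\<^esub> x" for x
    have vim: "T -` B \<inter> carrier (Qp p) = (\<lambda>x. a \<oplus>\<^bsub>Qp p\<^esub> x) ` B" if B: "B \<subseteq> carrier (Qp p)" for B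
    proof (intro equalityI subsetI)
      fix x assume x: "x \<in> T -` B \<inter> carrier (Qp p)"
      hence "x = a \<oplus>\<^bsub>Qp p\<^esub> T x" unfolding T_def using a by (simp add: Q.r_neg2 Q.add.m_assoc[symmetric] Q.r_neg)
      thus "x \<in> (\<lambda>x. a \<oplus>\<^bsub>Qp p\<^esub> x) ` B" using x by blast
    next
      fix x assume "x \<in> (\<lambda>x. a \<oplus>\<^bsub>Qp p\<^esub> x) ` B"
      then obtain b where b: "b \<in> B" "x = a \<oplus>\<^bsub>Qp p\<^esub> b" by blast
      have "T x = b" unfolding T_def b(2) using a b B by (auto simp: Q.r_neg1)
      thus "x \<in> T -` B \<inter> carrier (Qp p)" using a b B by auto
    qed
    have Tm: "T \<in> M \<rightarrow>\<^sub>M padic_borel p"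
    proof (rule measurable_sigma_sets[OF sets_padic_borel padic_cells_subset])
      show "T \<in> space M \<rightarrow> carrier (Qp p)" using a by (auto simp: spM T_def)
      fix B assume B: "B \<in> padic_cells"
      hence Bc: "B \<subseteq> carrier (Qp p)" using padic_cells_subset by blast
      from B consider "B = {}" | n m where "B = padic_cell p n m" by (auto simp: padic_cells_def)
      thus "T -` B \<inter> space M \<in> sets M"
      proof cases
        case 2
        then obtain k where "(\<lambda>x. a \<oplus>\<^bsub>Qp p\<^esub> x) ` B = padic_cell p n k"
          using padic_cell_translate_ex[OF a] by blast
        thus ?thesis using vim[OF Bc] padic_cell_in_borel by (simp add: spM sM)
      qed simp
    qed
    have ed: "emeasure (distr M (padic_borel p) T) B = emeasure M ((\<lambda>x. a \<oplus>\<^bsub>Qp p\<^esub> x) ` B)"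
      if "B \<in> sets (padic_borel p)" for B
      using emeasure_distr[OF Tm that] vim[of B] sets.sets_into_space[OF that] by (simp add: spM)
    have "distr M (padic_borel p) T = M"
    proof (rule padic_measure_eqI[OF _ sM _ cell])
      fix n m
      obtain k where "(\<lambda>x. a \<oplus>\<^bsub>Qp p\<^esub> x) ` padic_cell p n m = padic_cell p n k"
        using padic_cell_translate_ex[OF a] by blast
      thus "emeasure (distr M (padic_borel p) T) (padic_cell p n m) = 1 / ennreal (real p ^ n)"
        using ed[OF padic_cell_in_borel] cell by simp
    qed simp
    thus ?thesis using ed[of A] A sM by simp
  qed
  have "emeasure M {x \<in> carrier (Qp p). padic_norm p x \<le> 1} = 1"
    using cell[of 0 0] by (simp add: padic_cell_0)
  hence "is_padic_haar p M" using sM trans by (simp add: is_padic_haar_def)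
  thus ?thesis by blast
qed

theorem padic_haar_is_haar: "is_padic_haar p (padic_haar p)"
  unfolding padic_haar_def by (rule theI') (use padic_haar_exists is_padic_haar_unique in blast)

end

section \<open>Weighted Lebesgue spaces and the p-adic Hilbert-type operator\<close>

definition Qp_star_measure :: "nat \<Rightarrow> (nat \<Rightarrow> rat) set measure" where
  "Qp_star_measure p = restrict_space (padic_haar p) (carrier (Qp p) - {\<zero>\<^bsub>Qp p\<^esub>})"

definition padic_L1 :: "nat \<Rightarrow> real \<Rightarrow> ((nat \<Rightarrow> rat) set \<Rightarrow> real) set" where
  "padic_L1 p \<alpha> = {f \<in> borel_measurable (Qp_star_measure p).
     integrable (Qp_star_measure p) (\<lambda>x. \<bar>f x\<bar> * padic_norm p x powr \<alpha>)}"

definition padic_L1_norm :: "nat \<Rightarrow> real \<Rightarrow> ((nat \<Rightarrow> rat) set \<Rightarrow> real) \<Rightarrow> real" where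
  "padic_L1_norm p \<alpha> f = (\<integral>x. \<bar>f x\<bar> * padic_norm p x powr \<alpha> \<partial>Qp_star_measure p)"

definition padic_Linf_norm :: "nat \<Rightarrow> ((nat \<Rightarrow> rat) set \<Rightarrow> real) \<Rightarrow> ereal" where
  "padic_Linf_norm p f = esssup (Qp_star_measure p) (\<lambda>x. ereal \<bar>f x\<bar>)"

definition padic_Linf :: "nat \<Rightarrow> ((nat \<Rightarrow> rat) set \<Rightarrow> real) set" where
  "padic_Linf p = {f \<in> borel_measurable (Qp_star_measure p). padic_Linf_norm p f < \<infinity>}"

definition padic_hilbert_kernel ::
    "nat \<Rightarrow> real \<Rightarrow> real \<Rightarrow> real \<Rightarrow> (nat \<Rightarrow> rat) set \<Rightarrow> (nat \<Rightarrow> rat) set \<Rightarrow> real" where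
  "padic_hilbert_kernel p lam \<mu> \<nu> x y =
     padic_norm p x powr \<mu> * padic_norm p y powr \<nu> / max (padic_norm p x) (padic_norm p y) powr lam"

definition padic_hilbert ::
    "nat \<Rightarrow> real \<Rightarrow> real \<Rightarrow> real \<Rightarrow> ((nat \<Rightarrow> rat) set \<Rightarrow> real) \<Rightarrow> (nat \<Rightarrow> rat) set \<Rightarrow> real" where
  "padic_hilbert p lam \<mu> \<nu> f y =
     (\<integral>x. padic_hilbert_kernel p lam \<mu> \<nu> x y * f x \<partial>Qp_star_measure p)"

definition padic_hilbert_bounded_L1_Linf :: "nat \<Rightarrow> real \<Rightarrow> real \<Rightarrow> real \<Rightarrow> real \<Rightarrow> bool" where
  "padic_hilbert_bounded_L1_Linf p lam \<mu> \<nu> \<alpha> \<longleftrightarrow>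
     (\<forall>f\<in>padic_L1 p \<alpha>. AE y in Qp_star_measure p.
        integrable (Qp_star_measure p) (\<lambda>x. padic_hilbert_kernel p lam \<mu> \<nu> x y * f x)) \<and>
     (\<exists>C. \<forall>f\<in>padic_L1 p \<alpha>.
        padic_hilbert p lam \<mu> \<nu> f \<in> padic_Linf p \<and>
        padic_Linf_norm p (padic_hilbert p lam \<mu> \<nu> f) \<le> ereal (C * padic_L1_norm p \<alpha> f))"

end

theory Submission
  imports Defs
begin

text \<open>The operator is bounded exactly when its kernel is dominated by a multiple of the weight
  \<open>|x|^\<alpha>\<close>. Sufficiency is immediate. For necessity, the norm is locally constant on
  nonzero p-adic numbers, so testing on the indicator of a small ball around \<open>x\<close> and evaluating
  on a small ball around \<open>y\<close> recovers the kernel at \<open>(x, y)\<close>. Along \<open>|x| = |y| = p^k\<close> the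
  domination forces the homogeneity relation, and along \<open>|x| = 1\<close>, \<open>|y| = p^k\<close> it forces
  \<open>0 \<le> \<nu> \<le> \<lambda>\<close>; conversely the quotient
  \<open>|x|^(\<lambda>-\<nu>) |y|^\<nu> / max(|x|, |y|)^\<lambda>\<close> is then at most 1.\<close>

context
  fixes p :: nat
  assumes p: "prime p"
begin

interpretation Q: cring "Qp p" by (rule Qp_cring[OF p])

section \<open>Measurability of the norm and Haar measure on the nonzero p-adic numbers\<close>

lemma sets_padic_haar: "sets (padic_haar p) = sets (padic_borel p)"
  using padic_haar_is_haar[OF p] by (simp add: is_padic_haar_def)

lemma space_padic_haar: "space (padic_haar p) = carrier (Qp p)"
  using sets_eq_imp_space_eq[OF sets_padic_haar] by (simp add: p)

lemma padic_open_in_sets_padic_haar: "padic_open p U \<Longrightarrow> U \<in> sets (padic_haar p)"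
  unfolding sets_padic_haar padic_borel_def
  by (subst sets_measure_of) (auto simp: padic_open_def)

lemma padic_norm_le_max_diff:
  assumes "x \<in> carrier (Qp p)" "y \<in> carrier (Qp p)"
  shows "padic_norm p y \<le> max (padic_norm p (y \<ominus>\<^bsub>Qp p\<^esub> x)) (padic_norm p x)"
proof -
  have "y = (y \<ominus>\<^bsub>Qp p\<^esub> x) \<oplus>\<^bsub>Qp p\<^esub> x" using assms by algebra
  thus ?thesis using padic_norm_add[OF p Qp_diff_closed[OF p assms(2,1)] assms(1)] by simp
qed

text \<open>The ultrametric inequality is used in both directions: |y| cannot exceed |x|, and in |x|
  <= max(|x - y|, |y|) the first entry is below |x|, so |x| <= |y|.\<close>

lemma padic_norm_eq_of_diff_less:
  assumes "x \<in> carrier (Qp p)" "y \<in> carrier (Qp p)"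
    and "padic_norm p (y \<ominus>\<^bsub>Qp p\<^esub> x) < padic_norm p x"
  shows "padic_norm p y = padic_norm p x"
  using padic_norm_le_max_diff[OF assms(1,2)] padic_norm_le_max_diff[OF assms(2,1)] assms(3)
    padic_norm_diff_commute[OF p assms(1,2)] by linarith

lemma padic_norm_measurable_haar: "padic_norm p \<in> borel_measurable (padic_haar p)"
proof (subst borel_measurable_iff_less, intro allI)
  fix a :: real
  have "padic_open p {x \<in> carrier (Qp p). padic_norm p x < a}"
    unfolding padic_open_def
  proof (intro conjI ballI)
    fix x assume x: "x \<in> {x \<in> carrier (Qp p). padic_norm p x < a}"
    hence "0 < a" using padic_norm_nonneg[OF p, of x] by auto
    \<comment> \<open>The radius \<open>a\<close> itself serves every point: if |x| < a and |y - x|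
      < a, then |y| < a.\<close>
    thus "\<exists>e>0. \<forall>y\<in>carrier (Qp p). padic_norm p (y \<ominus>\<^bsub>Qp p\<^esub> x) < e \<longrightarrow>
        y \<in> {x \<in> carrier (Qp p). padic_norm p x < a}"
      using x by (intro exI[of _ a]) (auto intro: le_less_trans[OF padic_norm_le_max_diff])
  qed auto
  thus "{x \<in> space (padic_haar p). padic_norm p x < a} \<in> sets (padic_haar p)"
    using padic_open_in_sets_padic_haar by (simp add: space_padic_haar)
qed

lemma Qp_star_in_sets: "carrier (Qp p) - {\<zero>\<^bsub>Qp p\<^esub>} \<in> sets (padic_haar p)"
proof -
  have "carrier (Qp p) - {\<zero>\<^bsub>Qp p\<^esub>} = {x \<in> space (padic_haar p). padic_norm p x \<noteq> 0}"
    by (auto simp: space_padic_haar padic_norm_eq_0_iff p)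
  also have "\<dots> \<in> sets (padic_haar p)"
    using padic_norm_measurable_haar by measurable
  finally show ?thesis .
qed

lemma space_Qp_star: "space (Qp_star_measure p) = carrier (Qp p) - {\<zero>\<^bsub>Qp p\<^esub>}"
  by (auto simp: Qp_star_measure_def space_restrict_space space_padic_haar)

lemma padic_norm_measurable: "padic_norm p \<in> borel_measurable (Qp_star_measure p)"
  unfolding Qp_star_measure_def by (rule measurable_restrict_space1[OF padic_norm_measurable_haar])

lemma padic_norm_pos: "x \<in> space (Qp_star_measure p) \<Longrightarrow> 0 < padic_norm p x"
  using padic_norm_nonneg[OF p, of x] padic_norm_eq_0_iff[OF p, of x]
  by (auto simp: space_Qp_star less_le)

text \<open>Countably many unit balls, each of measure 1, cover the field. This is what later makes
  the operator's output measurable as an integral with a parameter.\<close>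

lemma sigma_finite_Qp_star: "sigma_finite_measure (Qp_star_measure p)"
proof -
  have "sigma_finite_measure (padic_haar p)"
  proof (standard, intro exI[of _ "range (padic_cell p 0)"] conjI ballI)
    show "range (padic_cell p 0) \<subseteq> sets (padic_haar p)"
      using padic_cell_in_borel[OF p] by (auto simp: sets_padic_haar)
    show "\<Union> (range (padic_cell p 0)) = space (padic_haar p)"
      using padic_cell_exists[OF p, of _ 0] by (auto simp: padic_cell_def space_padic_haar)
    show "emeasure (padic_haar p) A \<noteq> \<infinity>" if "A \<in> range (padic_cell p 0)" for A
      using that padic_haar_cell[OF p padic_haar_is_haar[OF p], of 0] by auto
  qed simp
  thus ?thesis unfolding Qp_star_measure_def
    by (rule sigma_finite_measure_restrict_space) (rule Qp_star_in_sets)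
qed

section \<open>Test balls and test points\<close>

text \<open>A cell around \<open>x\<close> of radius p^(-n) < |x| has constant norm |x|. It
  therefore avoids zero, and restricting the measure does not change its mass p^(-n).\<close>

lemma padic_small_ball:
  assumes "x \<in> space (Qp_star_measure p)"
  obtains A where "A \<in> sets (Qp_star_measure p)" "0 < emeasure (Qp_star_measure p) A"
    "emeasure (Qp_star_measure p) A < \<infinity>" "\<And>y. y \<in> A \<Longrightarrow> padic_norm p y = padic_norm p x"
proof -
  have x: "x \<in> carrier (Qp p)" using assms by (simp add: space_Qp_star)
  have "1 / real p < 1" using p_gt_1[OF p] by simp
  then obtain n where "(1 / real p) ^ n < padic_norm p x"
    using real_arch_pow_inv padic_norm_pos[OF assms] by blast
  hence n: "1 / real p ^ n < padic_norm p x" by (simp add: power_one_over)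
  obtain m where m: "x \<in> padic_cell p n m" using padic_cell_exists[OF p x] by blast
  have const: "padic_norm p y = padic_norm p x" if "y \<in> padic_cell p n m" for y
  proof (rule padic_norm_eq_of_diff_less[OF x])
    show "y \<in> carrier (Qp p)" using that by (simp add: padic_cell_def)
    show "padic_norm p (y \<ominus>\<^bsub>Qp p\<^esub> x) < padic_norm p x"
      using padic_cell_dist[OF p that m] n by linarith
  qed
  have sub: "padic_cell p n m \<subseteq> carrier (Qp p) - {\<zero>\<^bsub>Qp p\<^esub>}"
  proof
    fix y assume y: "y \<in> padic_cell p n m"
    hence "y \<in> carrier (Qp p)" by (simp add: padic_cell_def)
    thus "y \<in> carrier (Qp p) - {\<zero>\<^bsub>Qp p\<^esub>}"
      using const[OF y] padic_norm_pos[OF assms] padic_norm_eq_0_iff[OF p, of y] by auto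
  qed
  have cell: "padic_cell p n m \<in> sets (padic_haar p)"
    by (simp add: sets_padic_haar padic_cell_in_borel p)
  have "emeasure (Qp_star_measure p) (padic_cell p n m) = 1 / ennreal (real p ^ n)"
    unfolding Qp_star_measure_def using sub sets.Int_space_eq2[OF Qp_star_in_sets] Qp_star_in_sets
    by (subst emeasure_restrict_space)
      (simp_all add: padic_haar_cell[OF p padic_haar_is_haar[OF p]])
  also have "\<dots> = ennreal (1 / real p ^ n)"
    using p_gt_1[OF p] by (simp add: divide_ennreal flip: ennreal_1)
  finally have em: "emeasure (Qp_star_measure p) (padic_cell p n m) = ennreal (1 / real p ^ n)" .
  show ?thesis
  proof (rule that)
    show "padic_cell p n m \<in> sets (Qp_star_measure p)"
      unfolding Qp_star_measure_def
      using sub cell sets.Int_space_eq2[OF Qp_star_in_sets] Qp_star_in_sets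
      by (subst sets_restrict_space_iff) simp_all
    show "0 < emeasure (Qp_star_measure p) (padic_cell p n m)"
      "emeasure (Qp_star_measure p) (padic_cell p n m) < \<infinity>"
      unfolding em using p_gt_1[OF p] by auto
  qed (rule const)
qed

text \<open>The witnesses are the rationals p^(-n) and p^n, whose norms are p^n and p^(-n). They
  allow norms to tend to infinity or to zero.\<close>

lemma padic_norm_powers:
  obtains x y where "x \<in> space (Qp_star_measure p)" "padic_norm p x = real p powr real n"
    "y \<in> space (Qp_star_measure p)" "padic_norm p y = real p powr (- real n)"
proof -
  define q :: rat where "q = of_nat p ^ n"
  have p1: "real p > 1" by (rule p_gt_1[OF p])
  have q: "q \<noteq> 0" using p1 by (simp add: q_def)
  have nq: "rat_padic_norm p q = real p powr (- real n)"
    using p1 by (simp add: q_def rat_padic_norm_p_power[OF p] powr_minus powr_realpow inverse_eq_divide)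
  have "rat_padic_norm p (1 / q) * rat_padic_norm p q = 1"
    using q by (simp add: p flip: rat_padic_norm_mult[OF p])
  hence niq: "rat_padic_norm p (1 / q) = real p powr real n"
    using p1 by (simp add: nq powr_minus field_simps)
  have star: "padic_class p (\<lambda>_. r) \<in> space (Qp_star_measure p)" if "r \<noteq> 0" for r
    using that padic_norm_eq_0_iff[OF p, of "padic_class p (\<lambda>_. r)"]
    by (simp add: space_Qp_star padic_class_in_carrier p padic_norm_const)
  show ?thesis
    by (rule that[of "padic_class p (\<lambda>_. 1 / q)" "padic_class p (\<lambda>_. q)"])
      (use q star niq nq in \<open>auto simp: padic_norm_const[OF p]\<close>)
qed

section \<open>Boundedness of the operator as domination of its kernel\<close>

lemma padic_hilbert_kernel_nonneg: "0 \<le> padic_hilbert_kernel p lam \<mu> \<nu> x y"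
  by (simp add: padic_hilbert_kernel_def)

text \<open>For each fixed \<open>y\<close> the integrand is dominated by C |f(x)| |x|^\<alpha>,
  which is integrable. Convergence and the bound thus hold at every \<open>y\<close>, not merely
  almost everywhere.\<close>

lemma padic_hilbert_kernel_dominated_imp_bounded:
  assumes dom: "\<And>x y. x \<in> space (Qp_star_measure p) \<Longrightarrow> y \<in> space (Qp_star_measure p) \<Longrightarrow>
      padic_hilbert_kernel p lam \<mu> \<nu> x y \<le> C * padic_norm p x powr \<alpha>"
  shows "padic_hilbert_bounded_L1_Linf p lam \<mu> \<nu> \<alpha>"
proof -
  let ?M = "Qp_star_measure p" and ?K = "padic_hilbert_kernel p lam \<mu> \<nu>"
  interpret sigma_finite_measure ?M by (rule sigma_finite_Qp_star)
  note [measurable] = padic_norm_measurable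
  have Kf: "integrable ?M (\<lambda>x. ?K x y * f x)"
      "\<bar>padic_hilbert p lam \<mu> \<nu> f y\<bar> \<le> C * padic_L1_norm p \<alpha> f"
    if f: "f \<in> padic_L1 p \<alpha>" and y: "y \<in> space ?M" for f y
  proof -
    have [measurable]: "f \<in> borel_measurable ?M"
      and fi: "integrable ?M (\<lambda>x. C * (\<bar>f x\<bar> * padic_norm p x powr \<alpha>))"
      using f by (auto simp: padic_L1_def)
    have le: "norm (?K x y * f x) \<le> C * (\<bar>f x\<bar> * padic_norm p x powr \<alpha>)" if "x \<in> space ?M" for x
      using mult_right_mono[OF dom[OF that y] abs_ge_zero[of "f x"]]
      by (simp add: abs_mult padic_hilbert_kernel_nonneg mult_ac)
    have "(\<lambda>x. ?K x y * f x) \<in> borel_measurable ?M"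
      unfolding padic_hilbert_kernel_def by measurable
    thus i: "integrable ?M (\<lambda>x. ?K x y * f x)"
      by (rule Bochner_Integration.integrable_bound[OF fi])
        (auto intro!: AE_I2 order_trans[OF le] simp del: real_norm_def, simp)
    have "\<bar>padic_hilbert p lam \<mu> \<nu> f y\<bar> \<le> (\<integral>x. norm (?K x y * f x) \<partial>?M)"
      unfolding padic_hilbert_def using integral_norm_bound[of ?M "\<lambda>x. ?K x y * f x"] by simp
    also have "\<dots> \<le> (\<integral>x. C * (\<bar>f x\<bar> * padic_norm p x powr \<alpha>) \<partial>?M)"
      using le by (intro integral_mono integrable_norm i fi) auto
    finally show "\<bar>padic_hilbert p lam \<mu> \<nu> f y\<bar> \<le> C * padic_L1_norm p \<alpha> f"
      by (simp add: padic_L1_norm_def)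
  qed
  have meas: "padic_hilbert p lam \<mu> \<nu> f \<in> borel_measurable ?M" if "f \<in> padic_L1 p \<alpha>" for f
  proof -
    have [measurable]: "f \<in> borel_measurable ?M" using that by (simp add: padic_L1_def)
    show ?thesis
      unfolding padic_hilbert_def[abs_def] padic_hilbert_kernel_def by measurable
  qed
  have norm: "padic_Linf_norm p (padic_hilbert p lam \<mu> \<nu> f) \<le> ereal (C * padic_L1_norm p \<alpha> f)"
    if f: "f \<in> padic_L1 p \<alpha>" for f
    unfolding padic_Linf_norm_def using Kf(2)[OF f] meas[OF f] by (intro esssup_I AE_I2) auto
  show ?thesis
    unfolding padic_hilbert_bounded_L1_Linf_def padic_Linf_def
    \<comment> \<open>The norm bound is a real number, hence below infinity; this gives membership
      in \<open>padic_Linf\<close>.\<close>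
    using Kf(1) meas norm le_less_trans[OF norm less_ereal.simps(4)[THEN iffD2]]
    by (auto intro!: AE_I2 exI[of _ C])
qed

text \<open>The image of the indicator of a ball around \<open>x\<close> is constant on a ball
  around \<open>y\<close>. This turns an almost-everywhere bound into one at every pair, with the
  same constant.\<close>

lemma padic_hilbert_bounded_imp_kernel_dominated:
  assumes "padic_hilbert_bounded_L1_Linf p lam \<mu> \<nu> \<alpha>"
  obtains C where "\<And>x y. x \<in> space (Qp_star_measure p) \<Longrightarrow> y \<in> space (Qp_star_measure p) \<Longrightarrow>
      padic_hilbert_kernel p lam \<mu> \<nu> x y \<le> C * padic_norm p x powr \<alpha>"
proof -
  let ?M = "Qp_star_measure p" and ?K = "padic_hilbert_kernel p lam \<mu> \<nu>"
  obtain C where C: "\<And>f. f \<in> padic_L1 p \<alpha> \<Longrightarrow>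
      padic_Linf_norm p (padic_hilbert p lam \<mu> \<nu> f) \<le> ereal (C * padic_L1_norm p \<alpha> f)"
    using assms by (auto simp: padic_hilbert_bounded_L1_Linf_def)
  have "?K x y \<le> C * padic_norm p x powr \<alpha>" if x: "x \<in> space ?M" and y: "y \<in> space ?M" for x y
  proof -
    obtain A where A: "A \<in> sets ?M" "0 < emeasure ?M A" "emeasure ?M A < \<infinity>"
      "\<And>z. z \<in> A \<Longrightarrow> padic_norm p z = padic_norm p x" using padic_small_ball[OF x] by blast
    obtain B where B: "B \<in> sets ?M" "0 < emeasure ?M B"
      "\<And>z. z \<in> B \<Longrightarrow> padic_norm p z = padic_norm p y" using padic_small_ball[OF y] by blast
    \<comment> \<open>Finiteness matters here: \<open>measure\<close> would be 0 on a set of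
      infinite mass.\<close>
    have m: "0 < measure ?M A" using A by (simp add: measure_def enn2real_positive_iff)
    have e: "\<bar>indicator A z\<bar> * padic_norm p z powr \<alpha> = indicator A z * padic_norm p x powr \<alpha>" for z
      using A(4)[of z] by (auto simp: indicator_def)
    have i: "integrable ?M (indicator A :: _ \<Rightarrow> real)" using A by simp
    have L1: "indicator A \<in> padic_L1 p \<alpha>"
      unfolding padic_L1_def mem_Collect_eq e using A i by auto
    have norm: "padic_L1_norm p \<alpha> (indicator A) = measure ?M A * padic_norm p x powr \<alpha>"
      unfolding padic_L1_norm_def e using A sets.sets_into_space[OF A(1)] by (simp add: Int_absorb2)
    have H: "padic_hilbert p lam \<mu> \<nu> (indicator A) z = ?K x y * measure ?M A" if "z \<in> B" for z
    proof -
      \<comment> \<open>The kernel sees its arguments only through their norms, which are constant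
        on \<open>A\<close> and on \<open>B\<close>.\<close>
      have e: "?K w z * indicator A w = ?K x y * indicator A w" for w
        using A(4)[of w] B(3)[OF that] by (auto simp: indicator_def padic_hilbert_kernel_def)
      show ?thesis unfolding padic_hilbert_def e
        using A sets.sets_into_space[OF A(1)] by (simp add: Int_absorb2)
    qed
    have "AE z in ?M. ereal \<bar>padic_hilbert p lam \<mu> \<nu> (indicator A) z\<bar>
        \<le> padic_Linf_norm p (padic_hilbert p lam \<mu> \<nu> (indicator A))"
      unfolding padic_Linf_norm_def by (rule esssup_AE)
    hence ae: "AE z in ?M. \<bar>padic_hilbert p lam \<mu> \<nu> (indicator A) z\<bar>
        \<le> C * (measure ?M A * padic_norm p x powr \<alpha>)"
      by eventually_elim (use C[OF L1] in \<open>auto simp: norm dest: order_trans\<close>)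
    \<comment> \<open>A set of positive measure cannot lie in the exceptional null set; any
      surviving point of \<open>B\<close> will do.\<close>
    have "\<exists>z\<in>B. \<bar>padic_hilbert p lam \<mu> \<nu> (indicator A) z\<bar>
        \<le> C * (measure ?M A * padic_norm p x powr \<alpha>)"
    proof (rule ccontr)
      assume "\<not> ?thesis"
      with ae have "AE z in ?M. z \<notin> B" by (auto elim: eventually_mono)
      hence "emeasure ?M B = 0" using B(1) AE_iff_null_sets by blast
      thus False using B(2) by simp
    qed
    \<comment> \<open>The mass of \<open>A\<close> occurs on both sides and cancels, so the size of
      the ball does not affect the constant.\<close>
    hence "?K x y * measure ?M A \<le> C * padic_norm p x powr \<alpha> * measure ?M A"
      using H by (auto simp: mult_ac)
    thus ?thesis using m by simp
  qed
  thus ?thesis by (rule that)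
qed

section \<open>Domination of the kernel as a condition on the exponents\<close>

text \<open>Homogeneity splits |x|^\<mu> as |x|^\<alpha> |x|^(\<lambda>-\<nu>). Both \<lambda>-\<nu>
  and \<nu> are nonnegative, so replacing |x| and |y| by their maximum only increases the remaining
  product.\<close>

lemma padic_hilbert_kernel_dominated:
  assumes "lam = \<mu> + \<nu> - \<alpha>" "0 \<le> \<nu>" "\<nu> \<le> lam"
    and "x \<in> space (Qp_star_measure p)" "y \<in> space (Qp_star_measure p)"
  shows "padic_hilbert_kernel p lam \<mu> \<nu> x y \<le> padic_norm p x powr \<alpha>"
proof -
  define a b where "a = padic_norm p x" and "b = padic_norm p y"
  have ab: "0 < a" "0 < b" using assms(4,5) padic_norm_pos by (auto simp: a_def b_def)
  have "a powr (lam - \<nu>) * b powr \<nu> \<le> max a b powr (lam - \<nu>) * max a b powr \<nu>"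
    using ab assms by (intro mult_mono powr_mono2) auto
  also have "\<dots> = max a b powr lam" by (simp flip: powr_add)
  finally have "a powr \<alpha> * (a powr (lam - \<nu>) * b powr \<nu>) \<le> a powr \<alpha> * max a b powr lam"
    by (rule mult_left_mono) simp
  moreover have "a powr \<alpha> * a powr (lam - \<nu>) = a powr \<mu>"
    using assms(1) by (simp flip: powr_add)
  ultimately have "a powr \<mu> * b powr \<nu> \<le> a powr \<alpha> * max a b powr lam"
    by (simp flip: mult.assoc)
  thus ?thesis using ab
    by (simp add: padic_hilbert_kernel_def pos_divide_le_eq flip: a_def b_def)
qed

text \<open>For positive \<open>c\<close> the powers of p^c > 1 are unbounded. Each family of test
  points thereby yields a sign condition.\<close>

lemma exponent_nonpos_of_bounded_powr:
  assumes "\<And>n::nat. real p powr (real n * c) \<le> C"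
  shows "c \<le> 0"
proof (rule ccontr)
  assume "\<not> c \<le> 0"
  hence "1 < real p powr c" using powr_less_mono[of 0 c "real p"] p_gt_1[OF p] by simp
  then obtain n where "C < (real p powr c) ^ n" using real_arch_pow by blast
  also have "\<dots> = real p powr (real n * c)"
    using p_gt_1[OF p] by (simp add: powr_powr mult.commute flip: powr_realpow)
  finally show False using assms[of n] by simp
qed

lemma padic_hilbert_kernel_dominated_imp_exponents:
  assumes dom: "\<And>x y. x \<in> space (Qp_star_measure p) \<Longrightarrow> y \<in> space (Qp_star_measure p) \<Longrightarrow>
      padic_hilbert_kernel p lam \<mu> \<nu> x y \<le> C * padic_norm p x powr \<alpha>"
  shows "lam = \<mu> + \<nu> - \<alpha>" "0 \<le> \<nu>" "\<nu> \<le> lam"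
proof -
  have p1: "1 < real p" by (rule p_gt_1[OF p])
  \<comment> \<open>For |x| = p^s and |y| = p^t, the quotient of kernel and weight is a single power
    of \<open>p\<close>.\<close>
  have *: "real p powr (s * \<mu> + t * \<nu> - max s t * lam - s * \<alpha>) \<le> C"
    if "x \<in> space (Qp_star_measure p)" "padic_norm p x = real p powr s"
      "y \<in> space (Qp_star_measure p)" "padic_norm p y = real p powr t" for x y s t
  proof -
    have "max (real p powr s) (real p powr t) = real p powr max s t"
      using p1 by (auto simp: max_def)
    hence "real p powr (s * \<mu> + t * \<nu> - max s t * lam) \<le> C * real p powr (s * \<alpha>)"
      using dom[OF that(1,3)] by (simp add: padic_hilbert_kernel_def that powr_powr powr_add powr_diff)
    thus ?thesis using p1 by (simp add: powr_diff[of _ _ "s * \<alpha>"] pos_divide_le_eq)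
  qed
  obtain o1 where one: "o1 \<in> space (Qp_star_measure p)" "padic_norm p o1 = real p powr 0"
    using padic_norm_powers[of 0] by auto
  have "\<mu> + \<nu> - lam - \<alpha> \<le> 0"
  proof (rule exponent_nonpos_of_bounded_powr)
    fix n
    obtain x where x: "x \<in> space (Qp_star_measure p)" "padic_norm p x = real p powr real n"
      using padic_norm_powers by blast
    show "real p powr (real n * (\<mu> + \<nu> - lam - \<alpha>)) \<le> C"
      using *[OF x x] by (simp add: algebra_simps)
  qed
  \<comment> \<open>Norms tending to zero instead of infinity reverse the sign, so the two
    inequalities force equality.\<close>
  moreover have "- (\<mu> + \<nu> - lam - \<alpha>) \<le> 0"
  proof (rule exponent_nonpos_of_bounded_powr)
    fix n
    obtain x where x: "x \<in> space (Qp_star_measure p)" "padic_norm p x = real p powr (- real n)"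
      using padic_norm_powers by blast
    show "real p powr (real n * - (\<mu> + \<nu> - lam - \<alpha>)) \<le> C"
      using *[OF x x] by (simp add: algebra_simps)
  qed
  ultimately show "lam = \<mu> + \<nu> - \<alpha>" by linarith
  \<comment> \<open>With |x| = 1 and |y| = p^(-n) the maximum is 1, leaving the exponent -n
    \<nu>.\<close>
  have "- \<nu> \<le> 0"
  proof (rule exponent_nonpos_of_bounded_powr)
    fix n
    obtain x where x: "x \<in> space (Qp_star_measure p)" "padic_norm p x = real p powr (- real n)"
      using padic_norm_powers by blast
    show "real p powr (real n * - \<nu>) \<le> C" using *[OF one x] by simp
  qed
  thus "0 \<le> \<nu>" by simp
  \<comment> \<open>With |x| = 1 and |y| = p^n the maximum is p^n, leaving the exponent n (\<nu> -
    \<lambda>).\<close>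
  have "\<nu> - lam \<le> 0"
  proof (rule exponent_nonpos_of_bounded_powr)
    fix n
    obtain x where x: "x \<in> space (Qp_star_measure p)" "padic_norm p x = real p powr real n"
      using padic_norm_powers by blast
    show "real p powr (real n * (\<nu> - lam)) \<le> C"
      using *[OF one x] by (simp add: algebra_simps)
  qed
  thus "\<nu> \<le> lam" by simp
qed

lemma padic_hilbert_bounded_iff:
  "padic_hilbert_bounded_L1_Linf p lam \<mu> \<nu> \<alpha> \<longleftrightarrow> lam = \<mu> + \<nu> - \<alpha> \<and> 0 \<le> \<nu> \<and> \<nu> \<le> lam"
proof
  assume "padic_hilbert_bounded_L1_Linf p lam \<mu> \<nu> \<alpha>"
  then obtain C where "\<And>x y. x \<in> space (Qp_star_measure p) \<Longrightarrow> y \<in> space (Qp_star_measure p) \<Longrightarrow>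
      padic_hilbert_kernel p lam \<mu> \<nu> x y \<le> C * padic_norm p x powr \<alpha>"
    using padic_hilbert_bounded_imp_kernel_dominated by blast
  from padic_hilbert_kernel_dominated_imp_exponents[OF this]
  show "lam = \<mu> + \<nu> - \<alpha> \<and> 0 \<le> \<nu> \<and> \<nu> \<le> lam" by simp
next
  assume "lam = \<mu> + \<nu> - \<alpha> \<and> 0 \<le> \<nu> \<and> \<nu> \<le> lam"
  thus "padic_hilbert_bounded_L1_Linf p lam \<mu> \<nu> \<alpha>"
    by (intro padic_hilbert_kernel_dominated_imp_bounded[where C = 1])
      (simp add: padic_hilbert_kernel_dominated)
qed

end

text \<open>Given \<lambda> = \<mu> + \<nu> - \<alpha>, the inequality \<mu> - \<lambda> \<le>
  \<alpha> says 0 \<le> \<nu>, and \<alpha> \<le> \<mu> says \<nu> \<le> \<lambda>, so both forms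
  follow from one equivalence.\<close>

theorem theorem1p4:
  fixes p :: nat and lam \<mu> \<nu> \<alpha> :: real
  assumes "prime p"
  shows "(padic_hilbert_bounded_L1_Linf p lam \<mu> \<nu> \<alpha> \<longleftrightarrow>
            lam = \<mu> + \<nu> - \<alpha> \<and> \<mu> - lam \<le> \<alpha> \<and> \<alpha> \<le> \<mu>) \<and>
         (padic_hilbert_bounded_L1_Linf p lam \<mu> \<nu> \<alpha> \<longleftrightarrow>
            lam = \<mu> + \<nu> - \<alpha> \<and> 0 \<le> \<nu> \<and> \<nu> \<le> lam)"
  unfolding padic_hilbert_bounded_iff[OF assms] by auto

end
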